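(* Let $\mathcal{A}$ be a commutative unital $C^*$-algebra and let $\omega$ be a state on $\mathcal{A}$. Then there exists a unique regular Borel probability measure $\mu$ on the spectrum $\sigma(\mathcal{A})$ such that $$\int_{\sigma(\mathcal{A})}\mathrm{ev}_a\,d\mu=\omega(a)\qquad\text{for all }a\in\mathcal{A},$$ where $\mathrm{ev}_a:\sigma(\mathcal{A})\to\mathbb{C}$ sends a character $\chi$ to $\chi(a)$.
   Context: A state on a unital $C^*$-algebra $\mathcal{A}$ is a bounded linear functional $\omega:\mathcal{A}\to\mathbb{C}$ with $\omega(1_{\mathcal{A}})=1$ and $\omega(a^*a)\ge0$ for all $a\in\mathcal{A}$. The spectrum $\sigma(\mathcal{A})$ is the set of characters of $\mathcal{A}$ (nonzero continuous multiplicative linear functionals $\mathcal{A}\to\mathbb{C}$) with the subspace topology from the weak* topology on the topological dual $\mathcal{A}^*$; it is a compact Hausdorff space. Regular means outer regular by open sets and inner regular by compact sets on all Borel sets. *)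

theory Defs
  imports "HOL-Probability.Probability"
begin

text \<open>
  Unital C*-algebras. The real scalar multiplication inherited from the underlying real Banach
  algebra is the restriction of the complex one (\<open>scaleR_scaleC\<close>). The class \<open>ring_1\<close> only excludes
  the zero algebra, which has no states; \<open>norm 1 = 1\<close> is derived from the C*-identity below.
\<close>

class unital_cstar_algebra = real_normed_algebra + ring_1 + banach +
  fixes scaleC :: "complex \<Rightarrow> 'a \<Rightarrow> 'a" (infixr "*\<^sub>C" 75)
    and star :: "'a \<Rightarrow> 'a"
  assumes scaleC_add_right: "c *\<^sub>C (x + y) = c *\<^sub>C x + c *\<^sub>C y"
    and scaleC_add_left: "(c + d) *\<^sub>C x = c *\<^sub>C x + d *\<^sub>C x"
    and scaleC_scaleC: "c *\<^sub>C d *\<^sub>C x = (c * d) *\<^sub>C x"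
    and scaleR_scaleC: "r *\<^sub>R x = complex_of_real r *\<^sub>C x"
    and mult_scaleC_left: "(c *\<^sub>C x) * y = c *\<^sub>C (x * y)"
    and mult_scaleC_right: "x * (c *\<^sub>C y) = c *\<^sub>C (x * y)"
    and norm_scaleC: "norm (c *\<^sub>C x) = cmod c * norm x"
    and star_add: "star (x + y) = star x + star y"
    and star_scaleC: "star (c *\<^sub>C x) = cnj c *\<^sub>C star x"
    and star_mult: "star (x * y) = star y * star x"
    and star_star: "star (star x) = x"
    and cstar_identity: "norm (star x * x) = (norm x)\<^sup>2"
begin

lemma star_one: "star 1 = 1"
  by (metis mult_1_right star_mult star_star)

subclass real_normed_algebra_1
proof
  have "norm (1::'a) * norm (1::'a) = norm (1::'a)"
    using cstar_identity[of 1] by (simp only: star_one monoid_mult_class.power2_eq_square mult_1_left)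
  moreover have "norm (1::'a) \<noteq> 0"
    unfolding norm_eq_zero by (rule one_neq_zero)
  ultimately show "norm (1::'a) = 1"
    using mult_cancel_left2 by blast
qed

end

class comm_unital_cstar_algebra = unital_cstar_algebra + comm_ring_1

text \<open>
  The topological dual: \<open>bounded_linear\<close> refers to the real structure, hence the additional
  complex homogeneity.
\<close>

definition cdual :: "('a::unital_cstar_algebra \<Rightarrow> complex) set" where
  "cdual = {\<phi>. bounded_linear \<phi> \<and> (\<forall>c x. \<phi> (c *\<^sub>C x) = c * \<phi> x)}"

definition is_state :: "('a::unital_cstar_algebra \<Rightarrow> complex) \<Rightarrow> bool" where
  "is_state \<omega> \<longleftrightarrow> \<omega> \<in> cdual \<and> \<omega> 1 = 1 \<and> (\<forall>a. \<omega> (star a * a) \<in> \<real>\<^sub>\<ge>\<^sub>0)"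

definition evaluation :: "'a \<Rightarrow> ('a \<Rightarrow> complex) \<Rightarrow> complex" where
  "evaluation a \<phi> = \<phi> a"

text \<open>The coarsest topology on the dual for which all evaluations are continuous.\<close>

definition weak_star_topology :: "('a::unital_cstar_algebra \<Rightarrow> complex) topology" where
  "weak_star_topology =
     topology_generated_by {{\<phi> \<in> cdual. evaluation a \<phi> \<in> U} | a U. open U}"

definition spectrum :: "('a::unital_cstar_algebra \<Rightarrow> complex) set" where
  "spectrum = {\<phi> \<in> cdual. \<phi> \<noteq> (\<lambda>_. 0) \<and> (\<forall>x y. \<phi> (x * y) = \<phi> x * \<phi> y)}"

definition spectrum_topology :: "('a::unital_cstar_algebra \<Rightarrow> complex) topology" where
  "spectrum_topology = subtopology weak_star_topology spectrum"

lemma topspace_weak_star_topology: "topspace weak_star_topology = cdual"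
  unfolding weak_star_topology_def topology_generated_by_topspace by blast

lemma topspace_spectrum_topology: "topspace spectrum_topology = spectrum"
  by (auto simp: spectrum_topology_def topspace_weak_star_topology spectrum_def)

definition borel_of :: "'b topology \<Rightarrow> 'b measure" where
  "borel_of X = sigma (topspace X) {U. openin X U}"

text \<open>
  Outer regularity by open sets and inner regularity by compact sets, both on all Borel sets.
  In a Hausdorff space the compact sets are Borel, so their measures are meaningful.
\<close>

definition regular_borel_measure :: "'b topology \<Rightarrow> 'b measure \<Rightarrow> bool" where
  "regular_borel_measure X M \<longleftrightarrow>
     sets M = sets (borel_of X) \<and>
     (\<forall>A \<in> sets M.
        emeasure M A = (INF U \<in> {U. openin X U \<and> A \<subseteq> U}. emeasure M U) \<and>
        emeasure M A = (SUP K \<in> {K. compactin X K \<and> K \<subseteq> A}. emeasure M K))"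

end

theory Submission
  imports Defs
begin

text \<open>
  A minimal closed face of the weak* compact set of states maximizing \<open>\<phi> \<mapsto> Re (\<phi> a)\<close> is a single
  extreme state, and extreme states of a commutative algebra are characters. Hence for every \<open>a\<close> and
  every state \<open>\<omega>\<close> some character \<open>\<xi>\<close> satisfies \<open>Re (\<omega> a) \<le> Re (\<xi> a)\<close>. So \<open>\<omega>\<close> induces a positive
  functional on the functions \<open>\<xi> \<mapsto> Re (\<xi> a)\<close>, which are uniformly dense in the real continuous
  functions on the spectrum by Stone--Weierstrass; it extends by density, and the Riesz
  representation theorem gives the measure. No spectral theory of the algebra enters. Uniqueness
  follows from the same density and Urysohn's lemma.
\<close>

text \<open>The obstacle: the Gelfand map is not known to be injective here, so it is not even clear
  that \<open>Re (\<omega> a)\<close> depends only on the function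
  \<open>\<xi> \<mapsto> Re (\<xi> a)\<close>. Domination by a character, applied to
  \<open>a - b\<close>, gives this and monotonicity at once, since it turns an inequality on the
  spectrum into one for \<open>\<omega>\<close>. A minimal face is a single point because the
  maximizers of any further evaluation inside it form a face again, so all real parts, and via
  multiplication by the imaginary unit all values, are constant on it. The norm estimates rest on
  self-improving inequalities: states and characters are bounded by definition, so the operator norm
  \<open>M\<close> is a finite real, and \<open>M * M \<le> p * M\<close> may be divided by
  \<open>M\<close>. This takes the place of a spectral radius argument.\<close>

subsection \<open>Riesz representation on compact Hausdorff spaces\<close>

lemma sets_borel_of: "sets (borel_of X) = sigma_sets (topspace X) {U. openin X U}"
  unfolding borel_of_def by (rule sets_measure_of) (auto dest: openin_subset)

lemma space_borel_of: "space (borel_of X) = topspace X"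
  unfolding borel_of_def by (rule space_measure_of) (auto dest: openin_subset)

lemma openin_in_sets_borel_of: "openin X U \<Longrightarrow> U \<in> sets (borel_of X)"
  by (simp add: sets_borel_of sigma_sets.Basic)

lemma closedin_in_sets_borel_of:
  assumes "closedin X C"
  shows "C \<in> sets (borel_of X)"
proof -
  have "space (borel_of X) - (topspace X - C) \<in> sets (borel_of X)"
    using assms by (intro sets.compl_sets openin_in_sets_borel_of) auto
  with closedin_subset[OF assms] show ?thesis
    by (simp add: space_borel_of double_diff)
qed

lemma borel_measurable_continuous_map:
  assumes "sets M = sets (borel_of X)" "continuous_map X euclidean f"
  shows "f \<in> borel_measurable M"
proof (rule borel_measurableI)
  fix S :: "'b set" assume "open S"
  have "space M = topspace X"
    using sets_eq_imp_space_eq[OF assms(1)] by (simp add: space_borel_of)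
  then have "f -` S \<inter> space M = {x \<in> topspace X. f x \<in> S}" by auto
  moreover have "openin X {x \<in> topspace X. f x \<in> S}"
    using assms(2) \<open>open S\<close> by (intro openin_continuous_map_preimage) auto
  ultimately show "f -` S \<inter> space M \<in> sets M"
    using assms(1) openin_in_sets_borel_of by metis
qed

lemma compact_Hausdorff_Urysohn:
  assumes "compact_space X" "Hausdorff_space X"
    and "closedin X S" "closedin X T" "S \<inter> T = {}"
  obtains g where "continuous_map X euclideanreal g"
    "\<And>x. x \<in> topspace X \<Longrightarrow> 0 \<le> g x" "\<And>x. x \<in> topspace X \<Longrightarrow> g x \<le> 1"
    "\<And>x. x \<in> S \<Longrightarrow> g x = 0" "\<And>x. x \<in> T \<Longrightarrow> g x = 1"
proof -
  have "normal_space X"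
    using assms by (simp add: compact_Hausdorff_or_regular_imp_normal_space)
  then obtain g where g: "continuous_map X (top_of_set {0..1::real}) g"
      "g ` S \<subseteq> {0}" "g ` T \<subseteq> {1}"
    using Urysohn_lemma[of X S T 0 1] assms by (auto simp: disjnt_def)
  from g(1) have "continuous_map X euclideanreal g" "g \<in> topspace X \<rightarrow> {0..1}"
    by (auto simp: continuous_map_in_subtopology)
  with g(2,3) show thesis
    by (intro that[of g]) auto
qed

lemma continuous_map_bounded:
  assumes "compact_space X" "continuous_map X euclideanreal f"
  obtains B where "0 < B" "\<And>x. x \<in> topspace X \<Longrightarrow> \<bar>f x\<bar> \<le> B"
proof -
  have "compactin euclideanreal (f ` topspace X)"
    using assms by (intro image_compactin) (auto simp: compact_space_def)
  then have "bounded (f ` topspace X)"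
    by (simp add: compact_imp_bounded)
  then show thesis
    using that by (auto simp: bounded_pos)
qed

lemma integrable_continuous_map:
  assumes X: "compact_space X" and M: "prob_space M" "sets M = sets (borel_of X)"
    and f: "continuous_map X euclideanreal f"
  shows "integrable M f"
proof -
  interpret prob_space M by (rule M)
  have "space M = topspace X"
    using sets_eq_imp_space_eq[OF M(2)] by (simp add: space_borel_of)
  moreover obtain B where "\<And>x. x \<in> topspace X \<Longrightarrow> \<bar>f x\<bar> \<le> B"
    using continuous_map_bounded[OF X f] by auto
  ultimately show ?thesis
    using borel_measurable_continuous_map[OF M(2) f]
    by (intro integrable_const_bound[of _ B]) auto
qed

text \<open>Inner regularity of \<open>M\<close> reduces the claim to compact
  \<open>K \<subseteq> U\<close>; a Urysohn function between the indicators of \<open>K\<close> and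
  \<open>U\<close> has the same integral for both measures. Exchanging the measures later gives
  equality.\<close>

lemma regular_borel_measure_le_open:
  assumes X: "compact_space X" "Hausdorff_space X"
    and M: "regular_borel_measure X M" "prob_space M" and N: "regular_borel_measure X N" "prob_space N"
    and eq: "\<And>f. continuous_map X euclideanreal f \<Longrightarrow> (\<integral>x. f x \<partial>M) = (\<integral>x. f x \<partial>N)"
    and U: "openin X U"
  shows "emeasure M U \<le> emeasure N U"
proof -
  interpret M: prob_space M by (rule M)
  interpret N: prob_space N by (rule N)
  have sets: "sets M = sets (borel_of X)" "sets N = sets (borel_of X)"
    using M N by (auto simp: regular_borel_measure_def)
  then have space: "space M = topspace X" "space N = topspace X"
    by (auto dest!: sets_eq_imp_space_eq simp: space_borel_of)
  have "emeasure M U = (SUP K\<in>{K. compactin X K \<and> K \<subseteq> U}. emeasure M K)"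
    using M(1) U openin_in_sets_borel_of[OF U] sets unfolding regular_borel_measure_def by blast
  also have "\<dots> \<le> emeasure N U"
  proof (rule SUP_least)
    fix K assume "K \<in> {K. compactin X K \<and> K \<subseteq> U}"
    then have K: "closedin X K" "K \<subseteq> U"
      using compactin_imp_closedin[OF X(2)] by auto
    have disj: "(topspace X - U) \<inter> K = {}" using K by blast
    obtain g where g: "continuous_map X euclideanreal g"
      "\<And>x. x \<in> topspace X \<Longrightarrow> 0 \<le> g x" "\<And>x. x \<in> topspace X \<Longrightarrow> g x \<le> 1"
      "\<And>x. x \<in> topspace X - U \<Longrightarrow> g x = 0" "\<And>x. x \<in> K \<Longrightarrow> g x = 1"
      by (rule compact_Hausdorff_Urysohn[OF X _ K(1) disj]) (use U in auto)
    have int: "integrable M g" "integrable N g"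
      using integrable_continuous_map[OF X(1) _ _ g(1)] M(2) N(2) sets by auto
    have KM: "K \<in> sets M" and UN: "U \<in> sets N"
      using closedin_in_sets_borel_of[OF K(1)] openin_in_sets_borel_of[OF U] sets by auto
    have "M.prob K = (\<integral>x. indicator K x \<partial>M)"
      using sets.Int_space_eq2[OF KM] by simp
    also have "\<dots> \<le> (\<integral>x. g x \<partial>M)"
      using g int KM
      by (intro integral_mono integrable_real_indicator) (auto simp: indicator_def M.emeasure_eq_measure space)
    also have "\<dots> = (\<integral>x. g x \<partial>N)" using g(1) by (rule eq)
    also have "\<dots> \<le> (\<integral>x. indicator U x \<partial>N)"
      using g int UN
      by (intro integral_mono integrable_real_indicator) (auto simp: indicator_def N.emeasure_eq_measure space)
    also have "\<dots> = N.prob U"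
      using sets.Int_space_eq2[OF UN] by simp
    finally show "emeasure M K \<le> emeasure N U"
      by (simp add: M.emeasure_eq_measure N.emeasure_eq_measure ennreal_leI)
  qed
  finally show ?thesis .
qed

text \<open>Outer regularity propagates equality on open sets to all Borel sets.\<close>

lemma regular_borel_measure_eqI:
  assumes X: "compact_space X" "Hausdorff_space X"
    and M: "regular_borel_measure X M" "prob_space M" and N: "regular_borel_measure X N" "prob_space N"
    and eq: "\<And>f. continuous_map X euclideanreal f \<Longrightarrow> (\<integral>x. f x \<partial>M) = (\<integral>x. f x \<partial>N)"
  shows "M = N"
proof (rule measure_eqI)
  show sets: "sets M = sets N"
    using M N by (auto simp: regular_borel_measure_def)
  fix A assume A: "A \<in> sets M"
  have "emeasure M U = emeasure N U" if "openin X U" for U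
    using regular_borel_measure_le_open[OF X M N eq that]
      regular_borel_measure_le_open[OF X N M eq[symmetric] that] by (intro antisym)
  then have "(INF U\<in>{U. openin X U \<and> A \<subseteq> U}. emeasure M U) = (INF U\<in>{U. openin X U \<and> A \<subseteq> U}. emeasure N U)"
    by (intro INF_cong) auto
  then show "emeasure M A = emeasure N A"
    using M(1) N(1) A sets unfolding regular_borel_measure_def by metis
qed

section \<open>From a normalized positive functional to a content on open sets\<close>

locale positive_functional =
  fixes X :: "'b topology" and L :: "('b \<Rightarrow> real) \<Rightarrow> real"
  assumes compact: "compact_space X"
    and Hausdorff: "Hausdorff_space X"
    and add: "\<lbrakk>continuous_map X euclideanreal f; continuous_map X euclideanreal g\<rbrakk>
      \<Longrightarrow> L (\<lambda>x. f x + g x) = L f + L g"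
    and scale: "continuous_map X euclideanreal f \<Longrightarrow> L (\<lambda>x. c * f x) = c * L f"
    and mono: "\<lbrakk>continuous_map X euclideanreal f; continuous_map X euclideanreal g;
      \<And>x. x \<in> topspace X \<Longrightarrow> f x \<le> g x\<rbrakk> \<Longrightarrow> L f \<le> L g"
    and one: "L (\<lambda>_. 1) = 1"
begin

lemma const: "L (\<lambda>_. c) = c"
  using scale[of "\<lambda>_. 1" c] one by simp

lemma sum:
  assumes "\<And>k. k < (n::nat) \<Longrightarrow> continuous_map X euclideanreal (g k)"
  shows "L (\<lambda>x. \<Sum>k<n. g k x) = (\<Sum>k<n. L (g k))"
  using assms
proof (induction n)
  case (Suc n)
  have "continuous_map X euclideanreal (\<lambda>x. \<Sum>k<n. g k x)"
    using Suc.prems by (intro continuous_map_sum) auto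
  with Suc show ?case by (simp add: add)
qed (simp add: const)

text \<open>Cutting off costs at most \<open>e\<close>, because a normalized functional sends the
  constant \<open>e\<close> to \<open>e\<close>.\<close>

lemma le_cutoff:
  assumes "continuous_map X euclideanreal f"
  shows "L f \<le> L (\<lambda>x. max 0 (f x - e)) + e"
proof -
  have "L f \<le> L (\<lambda>x. max 0 (f x - e) + e)"
    using assms by (intro mono continuous_intros) auto
  also have "\<dots> = L (\<lambda>x. max 0 (f x - e)) + e"
    using assms by (subst add) (auto intro!: continuous_intros simp: const)
  finally show ?thesis .
qed

text \<open>The test functions only have to vanish outside \<open>U\<close>; their closed support
  may leave \<open>U\<close>. Arguments that need a closed set inside \<open>U\<close> take a level
  set \<open>{x. e \<le> f x}\<close> and pay with \<open>le_cutoff\<close>.\<close>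

definition below :: "'b set \<Rightarrow> ('b \<Rightarrow> real) set" where
  "below U = {f. continuous_map X euclideanreal f \<and>
     (\<forall>x\<in>topspace X. 0 \<le> f x \<and> f x \<le> 1) \<and> (\<forall>x\<in>topspace X - U. f x = 0)}"

definition content :: "'b set \<Rightarrow> ennreal" where
  "content U = (SUP f\<in>below U. ennreal (L f))"

definition outer :: "'b set \<Rightarrow> ennreal" where
  "outer A = (INF U\<in>{U. openin X U \<and> A \<subseteq> U}. content U)"

lemma belowI:
  assumes "continuous_map X euclideanreal f" "\<And>x. x \<in> topspace X \<Longrightarrow> 0 \<le> f x"
    "\<And>x. x \<in> topspace X \<Longrightarrow> f x \<le> 1" "\<And>x. x \<in> topspace X \<Longrightarrow> x \<notin> U \<Longrightarrow> f x = 0"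
  shows "f \<in> below U"
  using assms by (auto simp: below_def)

lemma belowD:
  assumes "f \<in> below U"
  shows "continuous_map X euclideanreal f" "x \<in> topspace X \<Longrightarrow> 0 \<le> f x"
    "x \<in> topspace X \<Longrightarrow> f x \<le> 1" "x \<in> topspace X \<Longrightarrow> x \<notin> U \<Longrightarrow> f x = 0"
  using assms by (auto simp: below_def)

lemma zero_below: "(\<lambda>_. 0) \<in> below U"
  by (auto simp: below_def)

lemma below_nonneg: "f \<in> below U \<Longrightarrow> 0 \<le> L f"
  using mono[of "\<lambda>_. 0" f] by (auto simp: below_def const)

lemma below_le_one: "f \<in> below U \<Longrightarrow> L f \<le> 1"
  using mono[of f "\<lambda>_. 1"] by (auto simp: below_def const)

lemma below_le_content: "f \<in> below U \<Longrightarrow> ennreal (L f) \<le> content U"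
  unfolding content_def by (rule SUP_upper)

lemma content_mono: "U \<subseteq> V \<Longrightarrow> content U \<le> content V"
  unfolding content_def by (intro SUP_subset_mono) (auto simp: below_def)

lemma content_le_one: "content U \<le> 1"
  unfolding content_def using below_le_one by (intro SUP_least) (auto simp: ennreal_le_1)

lemma content_empty: "content {} = 0"
proof -
  have "L f \<le> 0" if "f \<in> below {}" for f
    using mono[of f "\<lambda>_. 0"] that by (auto simp: below_def const)
  then show ?thesis
    unfolding content_def by (auto intro!: SUP_least antisym simp: ennreal_eq_0_iff)
qed

lemma content_topspace: "content (topspace X) = 1"
proof (rule antisym[OF content_le_one])
  show "1 \<le> content (topspace X)"
    using below_le_content[of "\<lambda>_. 1" "topspace X"] one by (simp add: below_def)
qed

lemma closedin_level: "continuous_map X euclideanreal f \<Longrightarrow> closedin X {x \<in> topspace X. e \<le> f x}"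
  using closedin_continuous_map_preimage[of X euclideanreal f "{e..}"] by simp

lemma openin_level: "continuous_map X euclideanreal f \<Longrightarrow> openin X {x \<in> topspace X. e < f x}"
  using openin_continuous_map_preimage[of X euclideanreal f "{e<..}"] by simp

text \<open>
  Cutting \<open>f\<close> off at a small height \<open>e\<close> moves its support into the closed set \<open>{f \<ge> e}\<close>; a Urysohn
  function separating the parts of that set outside \<open>U\<close> and outside \<open>V\<close> replaces a partition of unity.
\<close>

lemma content_Un:
  assumes U: "openin X U" and V: "openin X V"
  shows "content (U \<union> V) \<le> content U + content V"
  unfolding content_def[of "U \<union> V"]
proof (rule SUP_least, rule ennreal_le_epsilon)
  fix f and e :: real assume f: "f \<in> below (U \<union> V)" and e: "0 < e"
  note fD = belowD[OF f]
  define K where "K = {x \<in> topspace X. e \<le> f x}"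
  have K: "closedin X K"
    unfolding K_def using fD(1) by (rule closedin_level)
  have "K \<subseteq> U \<union> V"
    using fD(4) e by (force simp: K_def)
  then have disj: "(K - U) \<inter> (K - V) = {}" by blast
  obtain g where g: "continuous_map X euclideanreal g"
      "\<And>x. x \<in> topspace X \<Longrightarrow> 0 \<le> g x" "\<And>x. x \<in> topspace X \<Longrightarrow> g x \<le> 1"
      "\<And>x. x \<in> K - U \<Longrightarrow> g x = 0" "\<And>x. x \<in> K - V \<Longrightarrow> g x = 1"
    by (rule compact_Hausdorff_Urysohn[OF compact Hausdorff closedin_diff[OF K U]
          closedin_diff[OF K V] disj]) blast
  define h where "h x = max 0 (f x - e)" for x
  have h: "continuous_map X euclideanreal h"
    unfolding h_def using fD(1) by (intro continuous_intros)
  have h0: "0 \<le> h x" and h1: "x \<in> topspace X \<Longrightarrow> h x \<le> 1" for x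
    using fD(3)[of x] e by (auto simp: h_def)
  have hK: "h x = 0" if "x \<in> topspace X" "x \<notin> K" for x
    using that by (auto simp: h_def K_def)
  have U0: "h x * g x = 0" if "x \<in> topspace X" "x \<notin> U" for x
    using that hK[of x] g(4)[of x] by (cases "x \<in> K") auto
  have V0: "h x * (1 - g x) = 0" if "x \<in> topspace X" "x \<notin> V" for x
    using that hK[of x] g(5)[of x] by (cases "x \<in> K") auto
  have 1: "(\<lambda>x. h x * g x) \<in> below U"
    using h g(1-3) h0 h1 U0 by (intro belowI continuous_intros) (auto intro!: mult_le_one simp del: mult_eq_0_iff)
  have 2: "(\<lambda>x. h x * (1 - g x)) \<in> below V"
    using h g(1-3) h0 h1 V0 by (intro belowI continuous_intros) (auto intro!: mult_le_one simp del: mult_eq_0_iff)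
  have "L f \<le> L h + e"
    using le_cutoff[OF fD(1), of e] by (simp add: h_def[abs_def])
  also have "L h = L (\<lambda>x. h x * g x + h x * (1 - g x))"
    by (simp add: algebra_simps)
  also have "\<dots> = L (\<lambda>x. h x * g x) + L (\<lambda>x. h x * (1 - g x))"
    using 1 2 by (intro add) (auto dest: belowD)
  finally have "ennreal (L f) \<le> ennreal (L (\<lambda>x. h x * g x)) + ennreal (L (\<lambda>x. h x * (1 - g x))) + ennreal e"
    using below_nonneg[OF 1] below_nonneg[OF 2] e by (simp flip: ennreal_plus add: ennreal_leI)
  also have "\<dots> \<le> content U + content V + ennreal e"
    by (intro add_mono below_le_content 1 2 order_refl)
  finally show "ennreal (L f) \<le> content U + content V + ennreal e" .
qed

lemma content_finite_Union:
  fixes U :: "nat \<Rightarrow> 'b set"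
  assumes "\<And>i. openin X (U i)"
  shows "content (\<Union>i<n. U i) \<le> (\<Sum>i<n. content (U i))"
proof (induction n)
  case (Suc n)
  have "content (\<Union>i<Suc n. U i) = content ((\<Union>i<n. U i) \<union> U n)"
    by (simp add: lessThan_Suc Un_commute)
  also have "\<dots> \<le> content (\<Union>i<n. U i) + content (U n)"
    using assms by (intro content_Un) auto
  also have "\<dots> \<le> (\<Sum>i<Suc n. content (U i))"
    using Suc by (simp add: add_right_mono)
  finally show ?case .
qed (simp add: content_empty)

text \<open>The level set of a test function at height \<open>e\<close> is compact, so finitely many
  of the \<open>U i\<close>, and hence an initial segment of them, already carry its cut-off. This
  reduces countable to finite subadditivity.\<close>

lemma content_Union:
  assumes U: "\<And>i. openin X (U i)"
  shows "content (\<Union>i. U i) \<le> (\<Sum>i::nat. content (U i))"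
  unfolding content_def[of "\<Union>i. U i"]
proof (rule SUP_least, rule ennreal_le_epsilon)
  fix f and e :: real assume f: "f \<in> below (\<Union>i. U i)" and e: "0 < e"
  note fD = belowD[OF f]
  define K where "K = {x \<in> topspace X. e \<le> f x}"
  have "compactin X K"
    unfolding K_def using closedin_compact_space[OF compact] closedin_level[OF fD(1)] by blast
  moreover have "K \<subseteq> \<Union>(range U)"
    using fD(4) e by (force simp: K_def)
  ultimately obtain F where "finite F" "F \<subseteq> range U" "K \<subseteq> \<Union>F"
    using U compactinD[of X K "range U"] by auto
  then obtain I where I: "finite I" "K \<subseteq> (\<Union>i\<in>I. U i)"
    by (metis finite_subset_image)
  then obtain n where n: "I \<subseteq> {..<n}"
    by (auto simp: finite_nat_iff_bounded)
  have below: "(\<lambda>x. max 0 (f x - e)) \<in> below (\<Union>i<n. U i)"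
  proof (rule belowI)
    show "max 0 (f x - e) = 0" if "x \<in> topspace X" "x \<notin> (\<Union>i<n. U i)" for x
    proof -
      have "x \<notin> K" using that I n by auto
      then show ?thesis using that by (auto simp: K_def)
    qed
    show "max 0 (f x - e) \<le> 1" if "x \<in> topspace X" for x
      using fD(3)[OF that] e by auto
  qed (use fD(1) in \<open>auto intro!: continuous_intros\<close>)
  have "ennreal (L f) \<le> ennreal (L (\<lambda>x. max 0 (f x - e))) + ennreal e"
    using le_cutoff[OF fD(1), of e] below_nonneg[OF below] e
    by (simp flip: ennreal_plus add: ennreal_leI)
  also have "\<dots> \<le> (\<Sum>i<n. content (U i)) + ennreal e"
    using below_le_content[OF below] content_finite_Union[of U, OF U, of n]
    by (intro add_right_mono) (rule order_trans)
  also have "\<dots> \<le> (\<Sum>i. content (U i)) + ennreal e"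
    by (intro add_right_mono sum_le_suminf) auto
  finally show "ennreal (L f) \<le> (\<Sum>i. content (U i)) + ennreal e" .
qed

section \<open>The outer measure and its restriction to the Borel sets\<close>

lemma outer_open:
  assumes "openin X U"
  shows "outer U = content U"
  unfolding outer_def using assms
  by (intro antisym INF_lower INF_greatest) (auto intro: content_mono)

lemma outer_le_content: "openin X U \<Longrightarrow> A \<subseteq> U \<Longrightarrow> outer A \<le> content U"
  unfolding outer_def by (rule INF_lower) auto

lemma outer_mono: "A \<subseteq> B \<Longrightarrow> outer A \<le> outer B"
  unfolding outer_def by (intro INF_superset_mono) auto

lemma outer_measure_space_outer: "outer_measure_space (Pow (topspace X)) outer"
  unfolding outer_measure_space_def positive_def increasing_def countably_subadditive_def
proof (intro conjI allI impI ballI)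
  show "outer {} = 0"
    using outer_open[of "{}"] content_empty by simp
  fix A :: "nat \<Rightarrow> 'b set" assume A: "range A \<subseteq> Pow (topspace X)"
  show "outer (\<Union>i. A i) \<le> (\<Sum>i. outer (A i))"
  proof (rule ennreal_le_epsilon)
    \<comment> \<open>Finiteness of the sum makes every \<open>outer (A n)\<close> finite, which the
      strict inequality \<open>*\<close> requires. The increments \<open>e * (1/2)^Suc n\<close> add
      up to \<open>e\<close>.\<close>
    fix e :: real assume "0 < e" "(\<Sum>i. outer (A i)) < top"
    then have *: "outer (A n) < outer (A n) + ennreal (e * (1/2)^Suc n)" for n
      by (auto simp add: less_top dest!: ennreal_suminf_lessD)
    have "\<exists>U. openin X U \<and> A n \<subseteq> U \<and> content U \<le> outer (A n) + ennreal (e * (1/2)^Suc n)" for n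
      using *[of n] unfolding outer_def[of "A n"] by (subst (asm) INF_less_iff) (auto intro: less_imp_le)
    then obtain U where U: "\<And>n. openin X (U n)" "\<And>n. A n \<subseteq> U n"
        "\<And>n. content (U n) \<le> outer (A n) + ennreal (e * (1/2)^Suc n)"
      by metis
    have "outer (\<Union>i. A i) \<le> content (\<Union>i. U i)"
      using U by (intro outer_le_content) auto
    also have "\<dots> \<le> (\<Sum>n. content (U n))"
      by (rule content_Union) (rule U)
    also have "\<dots> \<le> (\<Sum>n. outer (A n) + ennreal (e * (1/2) ^ Suc n))"
      by (intro suminf_le U(3)) auto
    also have "\<dots> = (\<Sum>n. outer (A n)) + (\<Sum>n. ennreal e * ennreal ((1/2) ^ Suc n))"
      using \<open>0 < e\<close> by (subst suminf_add[symmetric])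
        (auto simp del: ennreal_suminf_cmult simp add: ennreal_mult[symmetric])
    also have "\<dots> = (\<Sum>n. outer (A n)) + ennreal e"
      unfolding ennreal_suminf_cmult
      by (subst suminf_ennreal_eq[OF zero_le_power power_half_series]) auto
    finally show "outer (\<Union>i. A i) \<le> (\<Sum>i. outer (A i)) + ennreal e" .
  qed
qed (rule outer_mono)

text \<open>Caratheodory's inequality for open \<open>V\<close>. The level set \<open>K\<close> of
  \<open>f\<close> is closed and lies in \<open>V \<inter> U\<close>, so \<open>V - K\<close> is an
  open set containing \<open>V - U\<close>. Any \<open>g\<close> below it can be added to the
  cut-off of \<open>f\<close> without leaving \<open>below V\<close>.\<close>

lemma content_split:
  assumes U: "openin X U" and V: "openin X V"
  shows "content (V \<inter> U) + outer (V - U) \<le> content V"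
proof (rule ennreal_le_epsilon)
  fix e :: real assume e: "0 < e"
  have *: "ennreal (L f) + outer (V - U) \<le> content V + ennreal e" if f: "f \<in> below (V \<inter> U)" for f
  proof -
    note fD = belowD[OF f]
    define K where "K = {x \<in> topspace X. e \<le> f x}"
    have K: "closedin X K"
      unfolding K_def using fD(1) by (rule closedin_level)
    have KVU: "K \<subseteq> V \<inter> U"
      using fD(4) e by (force simp: K_def)
    have cut: "continuous_map X euclideanreal (\<lambda>x. max 0 (f x - e))"
      using fD(1) by (intro continuous_intros)
    have **: "ennreal (L f) + ennreal (L g) \<le> content V + ennreal e" if g: "g \<in> below (V - K)" for g
    proof -
      note gD = belowD[OF g]
      have below: "(\<lambda>x. max 0 (f x - e) + g x) \<in> below V"
      proof (rule belowI)
        fix x assume x: "x \<in> topspace X"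
        show "max 0 (f x - e) + g x \<le> 1"
          \<comment> \<open>The summands never overlap: \<open>g\<close> vanishes on
            \<open>K\<close>, the cut-off of \<open>f\<close> off \<open>K\<close>.\<close>
          using fD(3)[OF x] gD(3,4)[OF x] e x by (cases "x \<in> K") (auto simp: K_def)
        show "0 \<le> max 0 (f x - e) + g x"
          using gD(2)[OF x] by auto
        show "max 0 (f x - e) + g x = 0" if "x \<notin> V"
          using fD(4)[OF x] gD(4)[OF x] e that by auto
      qed (intro continuous_map_add cut gD)
      have "ennreal (L f) + ennreal (L g) = ennreal (L f + L g)"
        using below_nonneg[OF f] below_nonneg[OF g] by simp
      also have "\<dots> \<le> ennreal (L (\<lambda>x. max 0 (f x - e) + g x) + e)"
        using le_cutoff[OF fD(1), of e] by (intro ennreal_leI) (simp add: add[OF cut gD(1)])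
      also have "\<dots> \<le> content V + ennreal e"
        using below_le_content[OF below] below_nonneg[OF below] e by (simp add: add_right_mono)
      finally show ?thesis .
    qed
    have "ennreal (L f) + outer (V - U) \<le> ennreal (L f) + content (V - K)"
      using V K KVU by (intro add_left_mono outer_le_content) (auto intro: openin_diff)
    also have "\<dots> = (SUP g\<in>below (V - K). ennreal (L f) + ennreal (L g))"
      unfolding content_def using zero_below by (subst ennreal_SUP_add_right) auto
    also have "\<dots> \<le> content V + ennreal e"
      using ** by (rule SUP_least)
    finally show ?thesis .
  qed
  have "content (V \<inter> U) + outer (V - U) = (SUP f\<in>below (V \<inter> U). ennreal (L f) + outer (V - U))"
    unfolding content_def using zero_below by (subst ennreal_SUP_add_left) auto
  also have "\<dots> \<le> content V + ennreal e"
    using * by (rule SUP_least)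
  finally show "content (V \<inter> U) + outer (V - U) \<le> content V + ennreal e" .
qed

text \<open>\<open>content_split\<close> handles open sets; an arbitrary \<open>A\<close> follows by
  taking the infimum over the open \<open>V\<close> that contain it.\<close>

lemma openin_in_lambda_system:
  assumes U: "openin X U"
  shows "U \<in> lambda_system (topspace X) (Pow (topspace X)) outer"
proof -
  interpret sigma_algebra "topspace X" "Pow (topspace X)" by (rule sigma_algebra_Pow)
  have "outer (A \<inter> U) + outer (A - U) = outer A" if "A \<subseteq> topspace X" for A
  proof (rule antisym)
    show "outer (A \<inter> U) + outer (A - U) \<le> outer A"
      unfolding outer_def[of A]
    proof (rule INF_greatest)
      fix V assume V: "V \<in> {V. openin X V \<and> A \<subseteq> V}"
      have "outer (A \<inter> U) + outer (A - U) \<le> content (V \<inter> U) + outer (V - U)"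
        using V U by (intro add_mono outer_le_content outer_mono) auto
      also have "\<dots> \<le> content V"
        using U V by (intro content_split) auto
      finally show "outer (A \<inter> U) + outer (A - U) \<le> content V" .
    qed
    have "outer ((A \<inter> U) \<union> (A - U)) \<le> outer (A \<inter> U) + outer (A - U)"
      using outer_measure_space_outer that
      by (intro subadditiveD[OF countably_subadditive_subadditive])
         (auto simp: outer_measure_space_def)
    then show "outer A \<le> outer (A \<inter> U) + outer (A - U)"
      by (simp add: Un_Diff_Int Un_commute Int_Diff_Un)
  qed
  with openin_subset[OF U] show ?thesis
    by (simp add: lambda_system_eq)
qed

text \<open>\<open>measure_of\<close> falls back to the zero measure unless \<open>outer\<close> is
  countably additive on the Borel sets; \<open>emeasure_representing\<close> settles this.\<close>

definition representing :: "'b measure" where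
  "representing = measure_of (topspace X) (sets (borel_of X)) outer"

lemma sets_representing: "sets representing = sets (borel_of X)"
  unfolding representing_def by (metis sets.sets_measure_of_eq space_borel_of)

lemma space_representing: "space representing = topspace X"
  using sets_eq_imp_space_eq[OF sets_representing] by (simp add: space_borel_of)

text \<open>By Caratheodory the lambda system is a sigma-algebra on which \<open>outer\<close> is a
  measure; it contains the open sets, hence all Borel sets.\<close>

lemma emeasure_representing:
  assumes "A \<in> sets (borel_of X)"
  shows "emeasure representing A = outer A"
proof -
  interpret sigma_algebra "topspace X" "Pow (topspace X)" by (rule sigma_algebra_Pow)
  have ms: "measure_space (topspace X) (lambda_system (topspace X) (Pow (topspace X)) outer) outer"
    using outer_measure_space_outer by (rule caratheodory_lemma)
  have sub: "sets (borel_of X) \<subseteq> lambda_system (topspace X) (Pow (topspace X)) outer"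
    unfolding sets_borel_of using ms openin_in_lambda_system
    by (intro sigma_algebra.sigma_sets_subset) (auto simp: measure_space_def)
  have sa: "sigma_algebra (topspace X) (sets (borel_of X))"
    using sets.sigma_algebra_axioms[of "borel_of X"] by (simp add: space_borel_of)
  have "measure_space (topspace X) (sets (borel_of X)) outer"
    using ms sa sub by (rule measure_down)
  with assms sa show ?thesis
    unfolding representing_def
    by (intro emeasure_measure_of_sigma) (auto simp: measure_space_def)
qed

lemma emeasure_representing_open: "openin X U \<Longrightarrow> emeasure representing U = content U"
  by (simp add: emeasure_representing openin_in_sets_borel_of outer_open)

lemma prob_space_representing: "prob_space representing"
  by (rule prob_spaceI) (simp add: space_representing emeasure_representing_open content_topspace)

text \<open>Outer regularity holds by construction. Inner regularity is outer regularity of the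
  complement: the complement of an open set is compact here, and the total mass is finite.\<close>

lemma regular_representing: "regular_borel_measure X representing"
  unfolding regular_borel_measure_def
proof (intro conjI ballI)
  interpret prob_space representing by (rule prob_space_representing)
  show "sets representing = sets (borel_of X)" by (rule sets_representing)
  fix A assume A: "A \<in> sets representing"
  have outer_reg: "emeasure representing B = (INF U\<in>{U. openin X U \<and> B \<subseteq> U}. emeasure representing U)"
    if "B \<in> sets representing" for B
    using that by (simp add: emeasure_representing_open emeasure_representing sets_representing outer_def
        cong: INF_cong_simp)
  show "emeasure representing A = (INF U\<in>{U. openin X U \<and> A \<subseteq> U}. emeasure representing U)"
    using A by (rule outer_reg)
  show "emeasure representing A = (SUP K\<in>{K. compactin X K \<and> K \<subseteq> A}. emeasure representing K)"
  proof (rule antisym)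
    show "(SUP K\<in>{K. compactin X K \<and> K \<subseteq> A}. emeasure representing K) \<le> emeasure representing A"
      using A by (intro SUP_least emeasure_mono) auto
    show "emeasure representing A \<le> (SUP K\<in>{K. compactin X K \<and> K \<subseteq> A}. emeasure representing K)"
    proof (rule ennreal_le_epsilon)
      fix e :: real assume e: "0 < e"
      have "emeasure representing (space representing - A) < emeasure representing (space representing - A) + ennreal e"
        using e by (simp add: emeasure_eq_measure ennreal_less_iff flip: ennreal_plus)
      then obtain U where U: "openin X U" "space representing - A \<subseteq> U"
          "emeasure representing U \<le> emeasure representing (space representing - A) + ennreal e"
        using outer_reg[of "space representing - A"] A
        by (auto simp: INF_less_iff intro: less_imp_le)
      define K where "K = topspace X - U"
      have K: "closedin X K" "K \<subseteq> A"
        using U by (auto simp: K_def space_representing)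
      have Us: "U \<in> sets representing"
        using U openin_in_sets_borel_of sets_representing by auto
      have "measure representing U \<le> measure representing (space representing - A) + e"
        using U(3) e by (simp add: emeasure_eq_measure flip: ennreal_plus)
      moreover have "measure representing (space representing - A) = 1 - measure representing A"
        using A by (rule prob_compl)
      moreover have "measure representing K = 1 - measure representing U"
        using prob_compl[OF Us] by (simp add: K_def space_representing)
      ultimately have "measure representing A \<le> measure representing K + e"
        by simp
      then have "emeasure representing A \<le> emeasure representing K + ennreal e"
        using e by (simp add: emeasure_eq_measure ennreal_leI flip: ennreal_plus)
      also have "emeasure representing K \<le> (SUP K\<in>{K. compactin X K \<and> K \<subseteq> A}. emeasure representing K)"
        using K closedin_compact_space[OF compact] by (intro SUP_upper) auto
      finally show "emeasure representing A \<le> (SUP K\<in>{K. compactin X K \<and> K \<subseteq> A}. emeasure representing K) + ennreal e"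
        by (simp add: add_right_mono)
    qed
  qed
qed

lemma integrable_representing: "continuous_map X euclideanreal f \<Longrightarrow> integrable representing f"
  by (rule integrable_continuous_map[OF compact prob_space_representing sets_representing])

section \<open>Comparison of the functional with the integral\<close>

lemma sum_clip:
  "(\<Sum>k<n. min (max (t - real k) 0) 1) = min (max t 0) (real n)"
  by (induction n) auto

text \<open>
  Layer cake: the slice of \<open>n f\<close> between the heights \<open>k\<close> and \<open>k + 1\<close> lies between the indicators of
  \<open>{n f > k + 1}\<close> and \<open>{n f > k}\<close>, so the two functionals differ by at most \<open>1\<close> on \<open>n f\<close>.
\<close>

lemma le_integral_unit:
  assumes f: "continuous_map X euclideanreal f"
    and f01: "\<And>x. x \<in> topspace X \<Longrightarrow> 0 \<le> f x" "\<And>x. x \<in> topspace X \<Longrightarrow> f x \<le> 1"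
  shows "L f \<le> (\<integral>x. f x \<partial>representing)"
proof -
  interpret prob_space representing by (rule prob_space_representing)
  have bound: "real n * L f \<le> real n * (\<integral>x. f x \<partial>representing) + 1" for n
  proof -
    define g where "g k x = min (max (real n * f x - real k) 0) 1" for k :: nat and x
    define U where "U k = {x \<in> topspace X. real k < real n * f x}" for k
    have nf: "continuous_map X euclideanreal (\<lambda>x. real n * f x)"
      using f by (intro continuous_intros)
    have g: "continuous_map X euclideanreal (g k)" for k
      unfolding g_def using f by (intro continuous_intros)
    have U: "openin X (U k)" for k
      unfolding U_def using nf by (rule openin_level)
    have sum_g: "(\<Sum>k<n. g k x) = real n * f x" if "x \<in> topspace X" for x
    proof -
      have "real n * f x \<le> real n * 1" "0 \<le> real n * f x"
        using f01[OF that] by (intro mult_left_mono mult_nonneg_nonneg; simp)+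
      then show ?thesis unfolding g_def sum_clip by simp
    qed
    have upper: "L (g k) \<le> prob (U k)" for k
    proof -
      have "g k \<in> below (U k)"
        using g by (intro belowI) (auto simp: g_def U_def)
      then have "ennreal (L (g k)) \<le> ennreal (prob (U k))"
        using below_le_content U emeasure_representing_open by (simp add: emeasure_eq_measure[symmetric])
      then show ?thesis by (simp add: ennreal_le_iff)
    qed
    have lower: "prob (U (Suc k)) \<le> (\<integral>x. g k x \<partial>representing)" for k
    proof -
      have "U (Suc k) \<in> sets representing"
        using U openin_in_sets_borel_of sets_representing by auto
      then have "prob (U (Suc k)) = (\<integral>x. indicator (U (Suc k)) x \<partial>representing)"
        using sets.Int_space_eq2[of "U (Suc k)" representing] by simp
      also have "\<dots> \<le> (\<integral>x. g k x \<partial>representing)"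
        using \<open>U (Suc k) \<in> _\<close> 
        by (intro integral_mono integrable_real_indicator integrable_representing[OF g])
           (auto simp: g_def U_def indicator_def emeasure_eq_measure)
      finally show ?thesis .
    qed
    have "real n * L f = L (\<lambda>x. real n * f x)"
      using f by (simp add: scale)
    also have "\<dots> \<le> L (\<lambda>x. \<Sum>k<n. g k x)"
      using nf g by (intro mono continuous_map_sum) (auto simp: sum_g)
    also have "\<dots> = (\<Sum>k<n. L (g k))"
      using g by (intro sum)
    also have "\<dots> \<le> (\<Sum>k<n. prob (U k))"
      by (intro sum_mono upper)
    \<comment> \<open>\<open>upper\<close> speaks of \<open>U k\<close> and \<open>lower\<close> of
      \<open>U (Suc k)\<close>. One extra term allows the index shift, so that
      \<open>prob (U 0) \<le> 1\<close> is the whole error.\<close>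
    also have "\<dots> \<le> (\<Sum>k<Suc n. prob (U k))"
      by simp
    also have "\<dots> = prob (U 0) + (\<Sum>k<n. prob (U (Suc k)))"
      by (rule sum.lessThan_Suc_shift)
    also have "\<dots> \<le> 1 + (\<Sum>k<n. \<integral>x. g k x \<partial>representing)"
      by (intro add_mono sum_mono lower) simp
    also have "(\<Sum>k<n. \<integral>x. g k x \<partial>representing) = (\<integral>x. (\<Sum>k<n. g k x) \<partial>representing)"
      using g integrable_representing by (intro Bochner_Integration.integral_sum[symmetric]) auto
    also have "\<dots> = (\<integral>x. real n * f x \<partial>representing)"
      by (intro Bochner_Integration.integral_cong) (auto simp: sum_g space_representing)
    finally show ?thesis by simp
  qed
  show ?thesis
  \<comment> \<open>The error 1 does not depend on \<open>n\<close>, so it disappears on division by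
    a large \<open>n\<close>.\<close>
  proof (rule ccontr)
    assume "\<not> ?thesis"
    then have d: "0 < L f - (\<integral>x. f x \<partial>representing)" by simp
    then obtain n where "1 < real n * (L f - (\<integral>x. f x \<partial>representing))"
      using ex_less_of_nat_mult by blast
    then show False using bound[of n] by (simp add: algebra_simps)
  qed
qed

text \<open>With a bound \<open>B\<close> of \<open>f\<close>, the function
  \<open>(f + B) / (2 * B)\<close> has values in the unit interval. Both functionals are linear and
  normalized, so the inequality transfers back.\<close>

lemma le_integral:
  assumes f: "continuous_map X euclideanreal f"
  shows "L f \<le> (\<integral>x. f x \<partial>representing)"
proof -
  interpret prob_space representing by (rule prob_space_representing)
  obtain B where B: "0 < B" "\<And>x. x \<in> topspace X \<Longrightarrow> \<bar>f x\<bar> \<le> B"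
    using continuous_map_bounded[OF compact f] by auto
  have c: "continuous_map X euclideanreal (\<lambda>x. f x + B)"
    using f by (intro continuous_intros)
  have "L (\<lambda>x. inverse (2 * B) * (f x + B)) \<le> (\<integral>x. inverse (2 * B) * (f x + B) \<partial>representing)"
  proof (rule le_integral_unit)
    fix x assume "x \<in> topspace X"
    then have "- B \<le> f x" "f x \<le> B" using B by force+
    then show "0 \<le> inverse (2 * B) * (f x + B)" "inverse (2 * B) * (f x + B) \<le> 1"
      using B(1) by (auto simp: field_simps)
  qed (use f in \<open>intro continuous_intros\<close>)
  moreover have "L (\<lambda>x. inverse (2 * B) * (f x + B)) = inverse (2 * B) * (L f + B)"
    using add[OF f, of "\<lambda>_. B"] by (subst scale[OF c]) (simp add: const)
  ultimately have "inverse (2 * B) * (L f + B) \<le> inverse (2 * B) * ((\<integral>x. f x \<partial>representing) + B)"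
    using integrable_representing[OF f] by (simp add: prob_space)
  then show ?thesis
    using B(1) by (subst (asm) mult_le_cancel_left_pos) auto
qed

text \<open>\<open>le_integral\<close> for the negative of \<open>f\<close> is the reverse
  inequality.\<close>

theorem has_bochner_integral_representing:
  assumes f: "continuous_map X euclideanreal f"
  shows "has_bochner_integral representing f (L f)"
proof -
  have "L (\<lambda>x. - 1 * f x) \<le> (\<integral>x. - 1 * f x \<partial>representing)"
    using f by (intro le_integral continuous_intros)
  then have "(\<integral>x. f x \<partial>representing) \<le> L f"
    using scale[OF f, of "- 1"] by simp
  with le_integral[OF f] integrable_representing[OF f] show ?thesis
    by (simp add: has_bochner_integral_iff)
qed

end

subsection \<open>The weak* topology\<close>

lemma open_vimage_coordinate:
  fixes U :: "'b::topological_space set"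
  assumes "open U"
  shows "open ((\<lambda>f::'a \<Rightarrow> 'b. f i) -` U)"
  using assms by (intro open_vimage continuous_on_product_coordinates)

text \<open>
  The arities for \<open>t0_space\<close> and \<open>t1_space\<close> have to come first: with only those that the library
  derives for countable domains, an arity for \<open>t2_space\<close> is rejected as not coregular.
\<close>

instance "fun" :: (type, t0_space) t0_space
proof
  fix f g :: "'a \<Rightarrow> 'b" assume "f \<noteq> g"
  then obtain i where "f i \<noteq> g i" by auto
  then obtain U where "open U" "\<not> (f i \<in> U \<longleftrightarrow> g i \<in> U)"
    using t0_space_class.t0_space by metis
  then show "\<exists>U. open U \<and> \<not> (f \<in> U \<longleftrightarrow> g \<in> U)"
    by (intro exI[of _ "(\<lambda>h. h i) -` U"]) (auto intro: open_vimage_coordinate)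
qed

instance "fun" :: (type, t1_space) t1_space
proof
  fix f g :: "'a \<Rightarrow> 'b" assume "f \<noteq> g"
  then obtain i where "f i \<noteq> g i" by auto
  then obtain U where "open U" "f i \<in> U" "g i \<notin> U"
    using t1_space by metis
  then show "\<exists>U. open U \<and> f \<in> U \<and> g \<notin> U"
    by (intro exI[of _ "(\<lambda>h. h i) -` U"]) (auto intro: open_vimage_coordinate)
qed

instance "fun" :: (type, t2_space) t2_space
proof
  fix f g :: "'a \<Rightarrow> 'b" assume "f \<noteq> g"
  then obtain i where "f i \<noteq> g i" by auto
  then obtain U V where UV: "open U" "open V" "f i \<in> U" "g i \<in> V" "U \<inter> V = {}"
    using hausdorff by metis
  with open_vimage_coordinate show "\<exists>U V. open U \<and> open V \<and> f \<in> U \<and> g \<in> V \<and> U \<inter> V = {}"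
    by (intro exI[of _ "(\<lambda>h. h i) -` U"] exI[of _ "(\<lambda>h. h i) -` V"]) auto
qed

text \<open>The type class topology on functions is the product topology, that is, pointwise
  convergence. Identifying the weak* topology with its trace on \<open>cdual\<close> makes Tychonoff
  and Stone-Weierstrass applicable.\<close>

lemma weak_star_topology_eq:
  "(weak_star_topology :: ('a::unital_cstar_algebra \<Rightarrow> complex) topology) = top_of_set cdual"
proof -
  let ?W = "weak_star_topology :: ('a \<Rightarrow> complex) topology"
  have "openin (top_of_set cdual) S" if S: "openin ?W S" for S
  proof (rule generate_topology_on_coarsest[of "openin (top_of_set cdual)"])
    show "generate_topology_on {{\<phi> \<in> cdual. evaluation a \<phi> \<in> U} |a U. open U} S"
      using S unfolding weak_star_topology_def openin_topology_generated_by_iff .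
    show "openin (top_of_set cdual) s" if "s \<in> {{\<phi> \<in> cdual. evaluation a \<phi> \<in> U} |a U. open U}"
      for s :: "('a \<Rightarrow> complex) set"
      using that
    proof safe
      fix a :: 'a and U :: "complex set" assume "open U"
      then have "open ((\<lambda>\<phi>. \<phi> a) -` U)"
        by (rule open_vimage_coordinate)
      moreover have "{\<phi> \<in> cdual. evaluation a \<phi> \<in> U} = cdual \<inter> (\<lambda>\<phi>. \<phi> a) -` U"
        by (auto simp: evaluation_def)
      ultimately show "openin (top_of_set cdual) {\<phi> \<in> cdual. evaluation a \<phi> \<in> U}"
        by (simp add: openin_open_Int)
    qed
  qed simp
  moreover have "openin ?W S" if S: "openin (top_of_set cdual) S" for S
  proof -
    have "continuous_map ?W euclidean (\<lambda>\<phi>. \<phi> a)" for a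
      unfolding continuous_map topspace_weak_star_topology
    proof (intro conjI allI impI)
      fix U :: "complex set" assume "openin euclidean U"
      then show "openin ?W {\<phi> \<in> cdual. \<phi> a \<in> U}"
        unfolding weak_star_topology_def
        by (intro topology_generated_by_Basis) (auto simp: evaluation_def)
    qed auto
    then have "continuous_map ?W (product_topology (\<lambda>_. euclidean) UNIV) (\<lambda>\<phi>. \<phi>)"
      by (intro continuous_map_coordinatewise_then_product) auto
    then have cont: "continuous_map ?W euclidean (\<lambda>\<phi>. \<phi>)"
      by (simp add: euclidean_product_topology)
    obtain V where "open V" "S = cdual \<inter> V"
      using S by (auto simp: openin_open)
    with openin_continuous_map_preimage[OF cont, of V] show ?thesis
      by (simp add: topspace_weak_star_topology Collect_conj_eq)
  qed
  ultimately show ?thesis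
    by (auto simp: topology_eq)
qed

lemma spectrum_subset_cdual: "spectrum \<subseteq> cdual"
  by (auto simp: spectrum_def)

lemma spectrum_topology_eq: "spectrum_topology = top_of_set spectrum"
  unfolding spectrum_topology_def weak_star_topology_eq
  by (simp add: subtopology_subtopology spectrum_subset_cdual Int_absorb1)

lemma cdualD:
  assumes "\<phi> \<in> cdual"
  shows "bounded_linear \<phi>" "\<phi> (c *\<^sub>C x) = c * \<phi> x" "\<phi> (x + y) = \<phi> x + \<phi> y"
    "\<phi> (x - y) = \<phi> x - \<phi> y"
  using assms linear_add[of \<phi>] linear_diff[of \<phi>] by (auto simp: cdual_def bounded_linear.linear)

lemma cdual_add: "\<phi> \<in> cdual \<Longrightarrow> \<psi> \<in> cdual \<Longrightarrow> (\<lambda>x. \<phi> x + \<psi> x) \<in> cdual"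
  by (auto simp: cdual_def bounded_linear_add algebra_simps)

lemma cdual_cmult: "\<phi> \<in> cdual \<Longrightarrow> (\<lambda>x. c * \<phi> x) \<in> cdual"
  by (auto simp: cdual_def bounded_linear_const_mult algebra_simps)

lemma cdual_mult_left: "\<phi> \<in> cdual \<Longrightarrow> (\<lambda>x. \<phi> (k * x)) \<in> cdual"
  by (auto simp: cdual_def mult_scaleC_right intro: bounded_linear_compose bounded_linear_mult_right)

subsection \<open>States and characters\<close>

lemma star_diff: "star (x - y) = star x - star (y::'a::unital_cstar_algebra)"
  by (metis add_diff_cancel diff_add_cancel star_add)

text \<open>States without normalization: forms such as
  \<open>y \<mapsto> \<phi> (star x * x * y)\<close> are positive but need not have the value 1 at
  the unit.\<close>

definition positive_form :: "('a::unital_cstar_algebra \<Rightarrow> complex) \<Rightarrow> bool" where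
  "positive_form \<phi> \<longleftrightarrow> \<phi> \<in> cdual \<and> (\<forall>a. \<phi> (star a * a) \<in> \<real>\<^sub>\<ge>\<^sub>0)"

lemma is_state_iff: "is_state \<phi> \<longleftrightarrow> positive_form \<phi> \<and> \<phi> 1 = 1"
  by (auto simp: is_state_def positive_form_def)

lemma positive_form_expand:
  assumes "positive_form \<phi>"
  shows "\<phi> (star x * x) + c * \<phi> (star x) + cnj c * \<phi> x + c * cnj c * \<phi> 1 \<in> \<real>\<^sub>\<ge>\<^sub>0"
proof -
  have lin: "\<phi> \<in> cdual" using assms by (simp add: positive_form_def)
  have "star (x + c *\<^sub>C 1) * (x + c *\<^sub>C 1) =
      star x * x + c *\<^sub>C star x + cnj c *\<^sub>C x + (c * cnj c) *\<^sub>C 1"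
    by (simp add: star_add star_scaleC star_one mult_scaleC_left mult_scaleC_right scaleC_scaleC
        scaleC_add_right algebra_simps)
  then have "\<phi> (star (x + c *\<^sub>C 1) * (x + c *\<^sub>C 1)) =
      \<phi> (star x * x) + c * \<phi> (star x) + cnj c * \<phi> x + c * cnj c * \<phi> 1"
    by (simp add: cdualD[OF lin])
  then show ?thesis
    using assms by (metis positive_form_def)
qed

lemma positive_form_square: "positive_form \<phi> \<Longrightarrow> \<phi> (star x * x) \<in> \<real>\<^sub>\<ge>\<^sub>0"
  by (simp add: positive_form_def)

lemma positive_form_one: "positive_form \<phi> \<Longrightarrow> \<phi> 1 \<in> \<real>\<^sub>\<ge>\<^sub>0"
  using positive_form_square[of \<phi> 1] by (simp add: star_one)

text \<open>The expansion must be real. With \<open>c = 1\<close> this matches the imaginary parts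
  of both sides, with \<open>c = \<i>\<close> the real parts.\<close>

lemma positive_form_star:
  assumes "positive_form \<phi>"
  shows "\<phi> (star x) = cnj (\<phi> x)"
  using positive_form_expand[OF assms, of x 1] positive_form_expand[OF assms, of x \<i>]
    positive_form_square[OF assms, of x] positive_form_one[OF assms]
  by (auto simp: complex_nonneg_Reals_iff complex_eq_iff)

lemma positive_form_Cauchy_Schwarz:
  assumes "positive_form \<phi>"
  shows "(cmod (\<phi> x))\<^sup>2 \<le> Re (\<phi> 1) * Re (\<phi> (star x * x))"
proof -
  define p q m where "p = Re (\<phi> 1)" and "q = Re (\<phi> (star x * x))" and "m = (cmod (\<phi> x))\<^sup>2"
  have p: "0 \<le> p" "\<phi> 1 = of_real p"
    using positive_form_one[OF assms] by (auto simp: p_def complex_nonneg_Reals_iff complex_eq_iff)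
  have m: "m = (Re (\<phi> x))\<^sup>2 + (Im (\<phi> x))\<^sup>2"
    by (simp add: m_def cmod_power2)
  have *: "0 \<le> q - 2 * t * m + t\<^sup>2 * m * p" for t :: real
    using positive_form_expand[OF assms, of x "- of_real t * \<phi> x"]
    by (simp add: positive_form_star[OF assms] complex_nonneg_Reals_iff p m flip: q_def)
       (simp add: algebra_simps power2_eq_square)
  have "m \<le> p * q"
  proof (cases "p = 0")
    case True
    have "m = 0"
    proof (rule ccontr)
      assume "m \<noteq> 0"
      \<comment> \<open>For \<open>p = 0\<close> the quadratic is \<open>q - 2 * t * m\<close>, and
        this \<open>t\<close> makes it -1.\<close>
      then show False using *[of "(q + 1) / (2 * m)"] True by simp
    qed
    with True show ?thesis by simp
  next
    case False
    \<comment> \<open>The quadratic in \<open>t\<close> is smallest at \<open>1 / p\<close>, with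
      value \<open>q - m / p\<close>.\<close>
    then show ?thesis using *[of "1 / p"] p(1) by (simp add: field_simps power2_eq_square)
  qed
  then show ?thesis by (simp add: p_def q_def m_def)
qed

text \<open>
  Cauchy--Schwarz bounds the square of the operator norm of \<open>\<phi>\<close> by \<open>\<phi> 1\<close> times the norm itself.
\<close>

lemma positive_form_bound:
  assumes "positive_form \<phi>"
  shows "cmod (\<phi> x) \<le> Re (\<phi> 1) * norm x"
proof -
  have bl: "bounded_linear \<phi>" using assms by (auto simp: positive_form_def cdual_def)
  define p M where "p = Re (\<phi> 1)" and "M = onorm \<phi>"
  have p: "0 \<le> p"
    using positive_form_one[OF assms] by (simp add: p_def complex_nonneg_Reals_iff)
  have M: "0 \<le> M" "cmod (\<phi> y) \<le> M * norm y" for y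
    unfolding M_def using bl by (auto intro: onorm_pos_le onorm)
  have "cmod (\<phi> y) \<le> sqrt (p * M) * norm y" for y
  proof (rule power2_le_imp_le)
    have "(cmod (\<phi> y))\<^sup>2 \<le> p * Re (\<phi> (star y * y))"
      unfolding p_def by (rule positive_form_Cauchy_Schwarz[OF assms])
    also have "\<dots> \<le> p * (M * norm (star y * y))"
      using p M(2)[of "star y * y"] complex_Re_le_cmod order_trans by (blast intro: mult_left_mono)
    also have "\<dots> = (sqrt (p * M) * norm y)\<^sup>2"
      using p M by (simp add: cstar_identity power_mult_distrib)
    finally show "(cmod (\<phi> y))\<^sup>2 \<le> (sqrt (p * M) * norm y)\<^sup>2" .
  qed (use p M in simp)
  then have "M \<le> sqrt (p * M)"
    unfolding M_def by (intro onorm_le) simp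
  then have "M\<^sup>2 \<le> (sqrt (p * M))\<^sup>2"
    using M(1) by (rule power_mono)
  then have "M * M \<le> p * M"
    using M(1) p by (simp add: power2_eq_square)
  then have "M \<le> p"
    using M(1) p by (cases "M = 0") auto
  then show ?thesis
    using M(2)[of x] unfolding p_def by (meson mult_right_mono norm_ge_zero order_trans)
qed

text \<open>Commutativity enters here. Bounding this form at a self-adjoint \<open>k\<close>
  compares \<open>\<phi> (star x * x * k)\<close> with \<open>\<phi> (star x * x)\<close>, which
  keeps small perturbations of a state positive.\<close>

lemma positive_form_mult_square:
  fixes \<phi> :: "'a::comm_unital_cstar_algebra \<Rightarrow> complex"
  assumes "positive_form \<phi>"
  shows "positive_form (\<lambda>y. \<phi> (star x * x * y))"
proof -
  have "star x * x * (star a * a) = star (x * a) * (x * a)" for a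
    by (simp add: star_mult mult_ac)
  then show ?thesis
    using assms unfolding positive_form_def by (auto intro: cdual_mult_left)
qed

section \<open>Characters are states\<close>

lemma character_one:
  assumes "\<xi> \<in> spectrum"
  shows "\<xi> 1 = 1"
proof -
  have mult: "\<xi> (x * y) = \<xi> x * \<xi> y" for x y using assms by (simp add: spectrum_def)
  obtain x where "\<xi> x \<noteq> 0" using assms unfolding spectrum_def by blast
  with mult[of 1 x] show ?thesis by simp
qed

text \<open>Evaluating at \<open>y * y\<close> shows that the operator norm \<open>M\<close>
  satisfies \<open>M * M \<le> M\<close>.\<close>

lemma character_bound:
  assumes "\<xi> \<in> spectrum"
  shows "cmod (\<xi> x) \<le> norm x"
proof -
  have mult: "\<xi> (x * y) = \<xi> x * \<xi> y" for x y using assms by (simp add: spectrum_def)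
  have bl: "bounded_linear \<xi>" using assms by (auto simp: spectrum_def cdual_def)
  define M where "M = onorm \<xi>"
  have M: "0 \<le> M" "cmod (\<xi> y) \<le> M * norm y" for y
    unfolding M_def using bl by (auto intro: onorm_pos_le onorm)
  have "cmod (\<xi> y) \<le> sqrt M * norm y" for y
  proof (rule power2_le_imp_le)
    have "(cmod (\<xi> y))\<^sup>2 = cmod (\<xi> (y * y))"
      by (simp add: mult norm_mult power2_eq_square)
    also have "\<dots> \<le> M * norm (y * y)" by (rule M(2))
    also have "\<dots> \<le> M * (norm y * norm y)" 
      using M(1) by (intro mult_left_mono norm_mult_ineq)
    also have "\<dots> = (sqrt M * norm y)\<^sup>2"
      using M(1) by (simp add: power_mult_distrib power2_eq_square)
    finally show "(cmod (\<xi> y))\<^sup>2 \<le> (sqrt M * norm y)\<^sup>2" .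
  qed (use M in simp)
  then have "M \<le> sqrt M"
    unfolding M_def by (intro onorm_le) simp
  then have "M\<^sup>2 \<le> (sqrt M)\<^sup>2"
    using M(1) by (rule power_mono)
  then have "M * M \<le> 1 * M"
    using M(1) by (simp add: power2_eq_square)
  then have "M \<le> 1"
    using M(1) by (cases "M = 0") auto
  then show ?thesis
    using M(2)[of x] mult_right_mono[of M 1 "norm x"] by simp
qed

text \<open>For self-adjoint \<open>h\<close>, compare \<open>\<bar>\<xi> (h + i t)\<bar>\<close> with \<open>\<parallel>h + i t\<parallel>\<close> for large \<open>t\<close>.\<close>

lemma character_selfadjoint:
  assumes \<xi>: "\<xi> \<in> spectrum" and h: "star h = h"
  shows "Im (\<xi> h) = 0"
proof (rule ccontr)
  assume nz: "Im (\<xi> h) \<noteq> 0"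
  define b where "b = Im (\<xi> h)"
  have lin: "\<xi> \<in> cdual" using \<xi> by (simp add: spectrum_def)
  have *: "(b + t)\<^sup>2 \<le> (norm h)\<^sup>2 + t\<^sup>2" for t :: real
  proof -
    define y where "y = h + (\<i> * of_real t) *\<^sub>C 1"
    have "star y * y = h * h + (of_real (t\<^sup>2)) *\<^sub>C 1 + (\<i> * of_real t + - \<i> * of_real t) *\<^sub>C h"
      unfolding scaleC_add_left
      by (simp add: y_def star_add star_scaleC star_one h mult_scaleC_left mult_scaleC_right scaleC_scaleC
          scaleC_add_right algebra_simps power2_eq_square)
    moreover have "(0::complex) *\<^sub>C h = 0"
      by (metis scaleC_add_left add_cancel_left_left add_0)
    ultimately have y: "star y * y = star h * h + (of_real (t\<^sup>2)) *\<^sub>C 1"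
      by (simp add: h)
    have "(b + t)\<^sup>2 = (Im (\<xi> y))\<^sup>2"
      by (simp add: y_def b_def cdualD[OF lin] character_one[OF \<xi>])
    also have "\<dots> \<le> (cmod (\<xi> y))\<^sup>2"
      by (simp add: cmod_power2)
    also have "\<dots> \<le> (norm y)\<^sup>2"
      using character_bound[OF \<xi>] by (intro power_mono) auto
    also have "\<dots> = norm (star h * h + (of_real (t\<^sup>2)) *\<^sub>C 1)"
      by (simp add: y flip: cstar_identity)
    also have "\<dots> \<le> norm (star h * h) + norm ((of_real (t\<^sup>2) :: complex) *\<^sub>C (1::'a))"
      by (rule norm_triangle_ineq)
    also have "\<dots> = (norm h)\<^sup>2 + t\<^sup>2"
      by (simp add: cstar_identity norm_scaleC norm_power)
    finally show ?thesis .
  qed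
  have "b\<^sup>2 + 2 * b * t \<le> (norm h)\<^sup>2" for t
    using *[of t] by (simp add: power2_sum)
  \<comment> \<open>This \<open>t\<close> makes \<open>2 * b * t\<close> exceed the right-hand side
    by 1.\<close>
  from this[of "((norm h)\<^sup>2 + 1) / (2 * b)"] show False
    using nz zero_le_power2[of b] unfolding b_def[symmetric]
    by (simp del: zero_le_power2)
qed

lemma scaleC_half_selfadjoint: "star ((1/2) *\<^sub>C (a + star a)) = (1/2) *\<^sub>C (a + star a)"
  by (simp add: star_scaleC star_add star_star add.commute)

lemma scaleC_ihalf_selfadjoint: "star ((-\<i>/2) *\<^sub>C (a - star a)) = (-\<i>/2) *\<^sub>C (a - star a)"
proof -
  have "star ((-\<i>/2) *\<^sub>C (a - star a)) = (\<i>/2) *\<^sub>C (star a - a)"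
    by (simp add: star_scaleC star_diff star_star)
  also have "\<dots> = (-\<i>/2) *\<^sub>C ((-1) *\<^sub>C (star a - a))"
    by (simp add: scaleC_scaleC)
  also have "(-1) *\<^sub>C (star a - a) = a - star a"
    using scaleR_scaleC[of "-1" "star a - a"] by simp
  finally show ?thesis .
qed

lemma Cartesian_decomposition:
  "a = (1/2) *\<^sub>C (a + star a) + \<i> *\<^sub>C ((-\<i>/2) *\<^sub>C (a - star a))"
proof -
  have "(1/2) *\<^sub>C (a + star a) + \<i> *\<^sub>C ((-\<i>/2) *\<^sub>C (a - star a)) = (1/2) *\<^sub>C (a + a)"
    by (simp add: scaleC_scaleC flip: scaleC_add_right)
  also have "\<dots> = a"
    using scaleR_scaleC[of "1/2" "a + a"] by (simp flip: scaleR_2)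
  finally show ?thesis by simp
qed

text \<open>Real values on the two self-adjoint parts of \<open>a\<close> give
  \<open>\<xi> (star a) = cnj (\<xi> a)\<close>, so \<open>\<xi> (star a * a)\<close> is the squared
  modulus of \<open>\<xi> a\<close>.\<close>

lemma spectrum_imp_is_state:
  assumes \<xi>: "\<xi> \<in> spectrum"
  shows "is_state \<xi>"
proof -
  have lin: "\<xi> \<in> cdual" and mult: "\<xi> (x * y) = \<xi> x * \<xi> y" for x y
    using \<xi> by (auto simp: spectrum_def)
  have "\<xi> (star a) = cnj (\<xi> a)" for a
    using character_selfadjoint[OF \<xi> scaleC_half_selfadjoint[of a]]
      character_selfadjoint[OF \<xi> scaleC_ihalf_selfadjoint[of a]]
    by (simp add: cdualD[OF lin] complex_eq_iff)
  then show ?thesis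
    unfolding is_state_def using lin character_one[OF \<xi>]
    by (auto simp: mult complex_nonneg_Reals_iff)
qed

text \<open>Boundedness with an unspecified constant is not a closed condition. The bound with
  constant 1 is automatic for states, and it turns every clause into a pointwise closed condition on
  finitely many values of \<open>\<phi>\<close>.\<close>

lemma is_state_iff_bounded:
  "is_state \<phi> \<longleftrightarrow> (\<forall>x y. \<phi> (x + y) = \<phi> x + \<phi> y) \<and> (\<forall>c x. \<phi> (c *\<^sub>C x) = c * \<phi> x) \<and> \<phi> 1 = 1
     \<and> (\<forall>a. \<phi> (star a * a) \<in> \<real>\<^sub>\<ge>\<^sub>0) \<and> (\<forall>x. \<phi> x \<in> cball 0 (norm x))" (is "_ \<longleftrightarrow> ?R")
proof
  assume "is_state \<phi>"
  then show ?R
    using positive_form_bound[of \<phi>] cdualD[of \<phi>] by (auto simp: is_state_iff positive_form_def)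
next
  assume R: ?R
  then have "bounded_linear \<phi>"
    by (intro bounded_linear_intro[of _ 1]) (auto simp: scaleR_scaleC scaleR_conv_of_real)
  with R show "is_state \<phi>" by (auto simp: is_state_def cdual_def)
qed

lemma closed_Collect_is_state: "closed (Collect (is_state :: ('a::unital_cstar_algebra \<Rightarrow> complex) \<Rightarrow> bool))"
proof -
  have eval: "continuous_on UNIV (\<lambda>\<phi>::'a \<Rightarrow> complex. \<phi> x)" for x
    by (rule continuous_on_product_coordinates)
  have closed_eval: "closed {\<phi>::'a \<Rightarrow> complex. \<phi> x \<in> C}" if "closed C" for x C
    using closed_vimage[OF that eval[of x]] by (simp add: vimage_def)
  show ?thesis
    unfolding is_state_iff_bounded
    by (intro closed_Collect_conj closed_Collect_all closed_Collect_eq closed_eval continuous_intros eval)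
       (auto simp: closed_nonneg_Reals_complex)
qed

text \<open>Banach-Alaoglu via Tychonoff: the states form a closed subset of a product of
  discs.\<close>

lemma compact_Collect_is_state: "compact (Collect (is_state :: ('a::unital_cstar_algebra \<Rightarrow> complex) \<Rightarrow> bool))"
proof -
  have "compactin (product_topology (\<lambda>_. euclidean) UNIV) (PiE UNIV (\<lambda>x::'a. cball (0::complex) (norm x)))"
    by (simp add: compactin_PiE)
  then have "compact (PiE UNIV (\<lambda>x::'a. cball (0::complex) (norm x)))"
    by (simp add: euclidean_product_topology)
  moreover have "Collect is_state \<subseteq> PiE UNIV (\<lambda>x::'a. cball (0::complex) (norm x))"
    by (auto simp: is_state_iff_bounded)
  ultimately show ?thesis
    using closed_Collect_is_state by (metis compact_Int_closed Int_absorb1)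
qed

text \<open>Being nonzero is not a closed condition; the normalization contained in
  \<open>is_state\<close> replaces it.\<close>

lemma spectrum_eq: "spectrum = {\<phi>. is_state \<phi> \<and> (\<forall>x y. \<phi> (x * y) = \<phi> x * \<phi> y)}"
  using spectrum_imp_is_state
  by (auto simp: spectrum_def is_state_def)

lemma compact_spectrum: "compact (spectrum :: ('a::unital_cstar_algebra \<Rightarrow> complex) set)"
proof -
  have "closed {\<phi> :: 'a \<Rightarrow> complex. \<forall>x y. \<phi> (x * y) = \<phi> x * \<phi> y}"
    by (intro closed_Collect_all closed_Collect_eq continuous_intros continuous_on_product_coordinates)
  then have "compact (Collect is_state \<inter> {\<phi> :: 'a \<Rightarrow> complex. \<forall>x y. \<phi> (x * y) = \<phi> x * \<phi> y})"
    by (intro compact_Int_closed compact_Collect_is_state)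
  then show ?thesis
    by (simp add: spectrum_eq Collect_conj_eq)
qed


section \<open>Closed faces of the state space and extreme states\<close>

text \<open>Closed faces, with convexity replaced by the condition on midpoints of \<open>\<phi> + \<psi>\<close> and \<open>\<phi> - \<psi>\<close>.\<close>

definition state_face :: "('a::unital_cstar_algebra \<Rightarrow> complex) set \<Rightarrow> bool" where
  "state_face F \<longleftrightarrow> F \<subseteq> Collect is_state \<and> F \<noteq> {} \<and> closed F \<and>
     (\<forall>\<phi>\<in>F. \<forall>\<psi>. is_state (\<lambda>x. \<phi> x + \<psi> x) \<and> is_state (\<lambda>x. \<phi> x - \<psi> x) \<longrightarrow> (\<lambda>x. \<phi> x + \<psi> x) \<in> F)"

lemma state_face_perturb:
  assumes "state_face F" "\<phi> \<in> F" "is_state (\<lambda>x. \<phi> x + \<psi> x)" "is_state (\<lambda>x. \<phi> x - \<psi> x)"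
  shows "(\<lambda>x. \<phi> x + \<psi> x) \<in> F" "(\<lambda>x. \<phi> x - \<psi> x) \<in> F"
proof -
  have *: "is_state (\<lambda>x. \<phi> x + \<theta> x) \<Longrightarrow> is_state (\<lambda>x. \<phi> x - \<theta> x) \<Longrightarrow> (\<lambda>x. \<phi> x + \<theta> x) \<in> F" for \<theta>
    using assms(1,2) unfolding state_face_def by blast
  show "(\<lambda>x. \<phi> x + \<psi> x) \<in> F" "(\<lambda>x. \<phi> x - \<psi> x) \<in> F"
    using *[of \<psi>] *[of "\<lambda>x. - \<psi> x"] assms by simp_all
qed

lemma state_face_all:
  fixes \<omega> :: "'a::unital_cstar_algebra \<Rightarrow> complex"
  assumes "is_state \<omega>"
  shows "state_face (Collect (is_state :: ('a \<Rightarrow> complex) \<Rightarrow> bool))"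
  using assms closed_Collect_is_state by (auto simp: state_face_def)

text \<open>Compactness provides a maximizer. If \<open>\<phi>\<close> is one and both perturbations
  by \<open>\<psi>\<close> lie in \<open>F\<close>, neither can exceed the maximum, so
  \<open>Re (\<psi> a) = 0\<close> and both attain it.\<close>

lemma state_face_maximizers:
  fixes a :: "'a::unital_cstar_algebra"
  assumes F: "state_face F"
  shows "state_face {\<phi> \<in> F. \<forall>\<psi>\<in>F. Re (\<psi> a) \<le> Re (\<phi> a)}" (is "state_face ?M")
proof -
  have cont: "continuous_on S (\<lambda>\<phi>::'a \<Rightarrow> complex. Re (\<phi> a))" for S
    by (intro continuous_on_Re continuous_on_subset[OF continuous_on_product_coordinates]) simp
  have F': "F \<subseteq> Collect is_state" "F \<noteq> {}" "closed F"
    using F by (auto simp: state_face_def)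
  have "compact F"
    using compact_Int_closed[OF compact_Collect_is_state F'(3)] F'(1) by (simp add: Int_absorb1)
  then have "\<exists>\<phi>\<in>F. \<forall>\<psi>\<in>F. Re (\<psi> a) \<le> Re (\<phi> a)"
    using F'(2) cont by (rule continuous_attains_sup)
  then have "?M \<noteq> {}" by blast
  moreover have "closed (F \<inter> (\<Inter>\<psi>\<in>F. {\<phi>. Re (\<psi> a) \<le> Re (\<phi> a)}))"
    by (intro closed_Int closed_INT ballI closed_Collect_le continuous_on_const cont F')
  then have "closed ?M"
    by (rule back_subst[of closed]) auto
  moreover have "(\<lambda>x. \<phi> x + \<psi> x) \<in> ?M"
    if "\<phi> \<in> ?M" "is_state (\<lambda>x. \<phi> x + \<psi> x)" "is_state (\<lambda>x. \<phi> x - \<psi> x)" for \<phi> \<psi>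
  proof -
    have *: "(\<lambda>x. \<phi> x + \<psi> x) \<in> F" "(\<lambda>x. \<phi> x - \<psi> x) \<in> F"
      using state_face_perturb[OF F] that by auto
    have max: "\<theta> \<in> F \<Longrightarrow> Re (\<theta> a) \<le> Re (\<phi> a)" for \<theta>
      using that by auto
    from max[OF *(1)] max[OF *(2)] have "Re (\<psi> a) = 0" by simp
    with * max show ?thesis by auto
  qed
  ultimately show ?thesis
    using F'(1) unfolding state_face_def by blast
qed

text \<open>A finite part of a chain has a least member, so the finite intersection property of the
  compact state space keeps the intersection nonempty.\<close>

lemma state_face_Inter:
  assumes "\<F> \<noteq> {}" and face: "\<And>F. F \<in> \<F> \<Longrightarrow> state_face F"
    and chain: "\<And>F G. F \<in> \<F> \<Longrightarrow> G \<in> \<F> \<Longrightarrow> F \<subseteq> G \<or> G \<subseteq> F"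
  shows "state_face (\<Inter>\<F>)"
proof -
  have fin: "\<exists>F\<in>\<G>. F \<subseteq> \<Inter>\<G>" if "finite \<G>" "\<G> \<noteq> {}" "\<G> \<subseteq> \<F>" for \<G>
    using that
  proof (induction rule: finite_ne_induct)
    case (insert G \<G>)
    then obtain F where F: "F \<in> \<G>" "F \<subseteq> \<Inter>\<G>" by blast
    have "F \<subseteq> G \<or> G \<subseteq> F"
      using insert.prems F(1) by (intro chain) auto
    with F show ?case by auto
  qed auto
  have "Collect is_state \<inter> \<Inter>\<F> \<noteq> {}"
  proof (rule compact_imp_fip[OF compact_Collect_is_state])
    show "closed F" if "F \<in> \<F>" for F
      using face[OF that] by (simp add: state_face_def)
    fix \<G> assume \<G>: "finite \<G>" "\<G> \<subseteq> \<F>"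
    obtain F where F: "F \<in> \<F>" "F \<subseteq> \<Inter>\<G>"
    proof (cases "\<G> = {}")
      case True
      then show thesis using that assms(1) by auto
    next
      case False
      then show thesis using that fin[OF \<G>(1) False \<G>(2)] \<G>(2) by blast
    qed
    with face[of F] show "Collect is_state \<inter> \<Inter>\<G> \<noteq> {}"
      unfolding state_face_def by blast
  qed
  moreover have "closed (\<Inter>\<F>)"
    using face by (intro closed_Inter) (auto simp: state_face_def)
  moreover have "\<Inter>\<F> \<subseteq> Collect is_state"
    using assms(1) face unfolding state_face_def by blast
  moreover have "(\<lambda>x. \<phi> x + \<psi> x) \<in> \<Inter>\<F>"
    if "\<phi> \<in> \<Inter>\<F>" "is_state (\<lambda>x. \<phi> x + \<psi> x)" "is_state (\<lambda>x. \<phi> x - \<psi> x)" for \<phi> \<psi>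
    using state_face_perturb(1)[OF face] that by blast
  ultimately show ?thesis
    unfolding state_face_def by blast
qed

lemma minimal_state_face:
  assumes "state_face F0"
  obtains F where "state_face F" "F \<subseteq> F0" "\<And>G. state_face G \<Longrightarrow> G \<subseteq> F \<Longrightarrow> G = F"
proof -
  define A where "A = {F. state_face F \<and> F \<subseteq> F0}"
  have "\<exists>F\<in>A. \<forall>G\<in>A. F \<supseteq> G \<longrightarrow> G = F"
  proof (rule predicate_Zorn)
    show "partial_order_on A (relation_of (\<supseteq>) A)"
      by (rule partial_order_on_relation_ofI) auto
    fix C assume "C \<in> Chains (relation_of (\<supseteq>) A)"
    then have C: "F \<in> A" "F \<subseteq> G \<or> G \<subseteq> F" if "F \<in> C" "G \<in> C" for F G
      using that by (auto simp: Chains_def relation_of_def)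
    show "\<exists>u\<in>A. \<forall>F\<in>C. u \<subseteq> F"
    proof (cases "C = {}")
      case True
      then show ?thesis using assms by (auto simp: A_def)
    next
      case False
      have "state_face (\<Inter>C)"
        using C by (intro state_face_Inter False) (auto simp: A_def)
      moreover have "\<Inter>C \<subseteq> F0"
        using False C by (fastforce simp: A_def)
      ultimately show ?thesis
        by (intro bexI[of _ "\<Inter>C"]) (auto simp: A_def)
    qed
  qed
  then show thesis
    using that by (auto simp: A_def)
qed

text \<open>
  If \<open>h\<close> is self-adjoint and \<open>k = h - \<phi> h\<close>, then \<open>\<phi> \<plusminus> s \<phi> (k \<cdot>)\<close> are states for small \<open>s > 0\<close>, since
  \<open>\<bar>\<phi> (x\<^sup>* x k)\<bar> \<le> \<phi> (x\<^sup>* x) \<parallel>k\<parallel>\<close>.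
\<close>

lemma extreme_state_multiplicative:
  fixes \<phi> :: "'a::comm_unital_cstar_algebra \<Rightarrow> complex"
  assumes \<phi>: "is_state \<phi>"
    and extreme: "\<And>\<psi>. is_state (\<lambda>x. \<phi> x + \<psi> x) \<Longrightarrow> is_state (\<lambda>x. \<phi> x - \<psi> x) \<Longrightarrow> \<psi> = (\<lambda>_. 0)"
  shows "\<phi> \<in> spectrum"
proof -
  have pos: "positive_form \<phi>" and one: "\<phi> 1 = 1" and lin: "\<phi> \<in> cdual"
    using \<phi> by (auto simp: is_state_iff positive_form_def)
  have selfadjoint: "\<phi> (h * y) = \<phi> h * \<phi> y" if h: "star h = h" for h y
  proof -
    \<comment> \<open>Since \<open>\<phi> k = 0\<close>, the perturbation leaves the value at the
      unit unchanged, and \<open>\<phi> (k * y) = 0\<close> is exactly multiplicativity at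
      \<open>h\<close>.\<close>
    define k where "k = h - \<phi> h *\<^sub>C 1"
    have "cnj (\<phi> h) = \<phi> h"
      using positive_form_star[OF pos, of h] h by simp
    then have k: "star k = k"
      by (simp add: k_def star_diff star_scaleC star_one h)
    define s where "s = 1 / (1 + norm k)"
    have s: "0 < s" "s * norm k \<le> 1"
      by (auto simp: s_def divide_simps add_pos_nonneg)
    define \<psi> where "\<psi> x = of_real s * \<phi> (k * x)" for x
    have \<psi>: "(\<lambda>x. c * \<psi> x) \<in> cdual" for c
      unfolding \<psi>_def[abs_def] using lin by (intro cdual_cmult cdual_mult_left)
    have "is_state (\<lambda>x. \<phi> x + of_real c * \<psi> x)" if c: "\<bar>c\<bar> = 1" for c :: real
      unfolding is_state_iff positive_form_def
    proof (intro conjI allI)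
      show "(\<lambda>x. \<phi> x + of_real c * \<psi> x) \<in> cdual"
        by (intro cdual_add lin \<psi>)
      show "\<phi> 1 + of_real c * \<psi> 1 = 1"
        by (simp add: \<psi>_def k_def cdualD[OF lin] one)
      fix x
      define \<rho> where "\<rho> y = \<phi> (star x * x * y)" for y
      have \<rho>: "positive_form \<rho>"
        unfolding \<rho>_def[abs_def] using pos by (rule positive_form_mult_square)
      have Im: "Im (\<rho> k) = 0"
        using positive_form_star[OF \<rho>, of k] by (simp add: k complex_eq_iff)
      have "\<bar>Re (\<rho> k)\<bar> \<le> Re (\<rho> 1) * norm k"
        using positive_form_bound[OF \<rho>, of k] abs_Re_le_cmod order_trans by blast
      then have "\<bar>s * Re (\<rho> k)\<bar> \<le> Re (\<rho> 1) * (s * norm k)"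
        using s(1) by (simp add: abs_mult mult.left_commute)
      also have "\<dots> \<le> Re (\<rho> 1) * 1"
        using s positive_form_one[OF \<rho>] by (intro mult_left_mono) (auto simp: complex_nonneg_Reals_iff)
      finally have "\<bar>c * (s * Re (\<rho> k))\<bar> \<le> Re (\<rho> 1)"
        using c by (simp add: abs_mult)
      then have "\<rho> 1 + of_real c * (of_real s * \<rho> k) \<in> \<real>\<^sub>\<ge>\<^sub>0"
        using Im positive_form_one[OF \<rho>] by (auto simp: complex_nonneg_Reals_iff abs_le_iff)
      then show "\<phi> (star x * x) + of_real c * \<psi> (star x * x) \<in> \<real>\<^sub>\<ge>\<^sub>0"
        by (simp add: \<rho>_def \<psi>_def mult.commute[of k])
    qed
    from this[of 1] this[of "-1"] have "\<psi> = (\<lambda>_. 0)"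
      by (intro extreme) simp_all
    then have "\<phi> (k * y) = 0"
      using s(1) by (auto simp: \<psi>_def fun_eq_iff)
    then show ?thesis
      by (simp add: k_def left_diff_distrib mult_scaleC_left cdualD[OF lin])
  qed
  have "\<phi> (x * y) = \<phi> x * \<phi> y" for x y
  proof -
    define h where "h = (1/2) *\<^sub>C (x + star x)"
    define k where "k = (-\<i>/2) *\<^sub>C (x - star x)"
    have "star h = h" "star k = k"
      unfolding h_def k_def by (rule scaleC_half_selfadjoint scaleC_ihalf_selfadjoint)+
    then have "\<phi> ((h + \<i> *\<^sub>C k) * y) = \<phi> (h + \<i> *\<^sub>C k) * \<phi> y"
      by (simp add: distrib_right mult_scaleC_left cdualD[OF lin] selfadjoint)
    moreover have "h + \<i> *\<^sub>C k = x"
      unfolding h_def k_def by (rule Cartesian_decomposition[symmetric])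
    ultimately show ?thesis by simp
  qed
  then show ?thesis
    using \<phi> by (simp add: spectrum_eq)
qed

theorem exists_dominating_character:
  fixes \<omega> :: "'a::comm_unital_cstar_algebra \<Rightarrow> complex"
  assumes "is_state \<omega>"
  obtains \<xi> where "\<xi> \<in> spectrum" "Re (\<omega> a) \<le> Re (\<xi> a)"
proof -
  obtain F where F: "state_face F" "F \<subseteq> {\<phi> \<in> Collect is_state. \<forall>\<psi>\<in>Collect is_state. Re (\<psi> a) \<le> Re (\<phi> a)}"
      and minimal: "\<And>G. state_face G \<Longrightarrow> G \<subseteq> F \<Longrightarrow> G = F"
    by (rule minimal_state_face[OF state_face_maximizers[OF state_face_all[OF assms]]]) blast
  then obtain \<phi> where \<phi>: "\<phi> \<in> F" "is_state \<phi>"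
    unfolding state_face_def by blast
  \<comment> \<open>By minimality the maximizers at any \<open>b\<close> are all of
    \<open>F\<close>, so every member of \<open>F\<close> is a maximizer.\<close>
  have Re_le: "Re (\<psi> b) \<le> Re (\<theta> b)" if "\<psi> \<in> F" "\<theta> \<in> F" for \<psi> \<theta> b
    using minimal[OF state_face_maximizers[OF F(1), of b]] that by blast
  have singleton: "\<psi> = \<phi>" if \<psi>: "\<psi> \<in> F" for \<psi>
  proof
    fix b
    have lin: "\<phi> \<in> cdual" "\<psi> \<in> cdual"
      using \<psi> \<phi>(1) F(1) by (auto simp: state_face_def is_state_def)
    have Re_eq: "Re (\<psi> c) = Re (\<phi> c)" for c
      using Re_le[OF \<psi> \<phi>(1), of c] Re_le[OF \<phi>(1) \<psi>, of c] by simp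
    with Re_eq[of "\<i> *\<^sub>C b"] show "\<psi> b = \<phi> b"
      by (simp add: complex_eq_iff cdualD[OF lin(1)] cdualD[OF lin(2)])
  qed
  have "\<phi> \<in> spectrum"
  proof (rule extreme_state_multiplicative[OF \<phi>(2)])
    fix \<psi> assume "is_state (\<lambda>x. \<phi> x + \<psi> x)" "is_state (\<lambda>x. \<phi> x - \<psi> x)"
    then have "(\<lambda>x. \<phi> x + \<psi> x) = \<phi>"
      using state_face_perturb(1)[OF F(1) \<phi>(1)] singleton by blast
    then show "\<psi> = (\<lambda>_. 0)" by (simp add: fun_eq_iff)
  qed
  moreover have "Re (\<omega> a) \<le> Re (\<phi> a)"
    using F(2) \<phi>(1) assms by blast
  ultimately show thesis by (rule that)
qed

subsection \<open>The functional of a state on the continuous functions of the spectrum\<close>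

lemma compact_space_spectrum_topology: "compact_space spectrum_topology"
  unfolding spectrum_topology_eq
  by (intro compact_space_subtopology) (simp add: compact_spectrum)

lemma Hausdorff_space_euclidean_t2: "Hausdorff_space (euclidean :: 'b::t2_space topology)"
  unfolding Hausdorff_space_def disjnt_def topspace_euclidean open_openin[symmetric]
  by (blast dest: hausdorff)

lemma Hausdorff_space_spectrum_topology: "Hausdorff_space spectrum_topology"
  unfolding spectrum_topology_eq by (intro Hausdorff_space_subtopology Hausdorff_space_euclidean_t2)

lemma spectrum_Stone_Weierstrass:
  fixes f :: "('a::unital_cstar_algebra \<Rightarrow> complex) \<Rightarrow> real"
  assumes f: "continuous_map spectrum_topology euclideanreal f" and e: "0 < e"
  obtains a where "\<And>\<xi>. \<xi> \<in> spectrum \<Longrightarrow> \<bar>f \<xi> - Re (\<xi> a)\<bar> \<le> e"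
proof -
  define R where "R = {g. \<exists>a::'a. \<forall>\<xi>\<in>spectrum. g \<xi> = Re (\<xi> a)}"
  have RI: "g \<in> R" if "\<And>\<xi>. \<xi> \<in> spectrum \<Longrightarrow> g \<xi> = Re (\<xi> a)" for g a
    using that by (auto simp: R_def)
  have lin: "\<xi> \<in> cdual" if "\<xi> \<in> spectrum" for \<xi> :: "'a \<Rightarrow> complex"
    using that by (simp add: spectrum_def)
  interpret function_ring_on R "spectrum :: ('a \<Rightarrow> complex) set"
  proof
    show "compact (spectrum :: ('a \<Rightarrow> complex) set)" by (rule compact_spectrum)
    show "continuous_on spectrum g" if "g \<in> R" for g
    proof -
      obtain a where a: "\<And>\<xi>. \<xi> \<in> spectrum \<Longrightarrow> g \<xi> = Re (\<xi> a)" using \<open>g \<in> R\<close> by (auto simp: R_def)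
      have "continuous_on spectrum (\<lambda>\<xi>. Re (\<xi> a))"
        by (intro continuous_on_Re continuous_on_subset[OF continuous_on_product_coordinates]) simp
      then show ?thesis using a by (simp cong: continuous_on_cong)
    qed
    fix g h assume "g \<in> R" "h \<in> R"
    then obtain a b where a: "\<And>\<xi>. \<xi> \<in> spectrum \<Longrightarrow> g \<xi> = Re (\<xi> a)"
      and b: "\<And>\<xi>. \<xi> \<in> spectrum \<Longrightarrow> h \<xi> = Re (\<xi> b)" by (auto simp: R_def)
    show "(\<lambda>x. g x + h x) \<in> R"
      by (rule RI[of _ "a + b"]) (simp add: a b cdualD[OF lin])
    show "(\<lambda>x. g x * h x) \<in> R"
    \<comment> \<open>The real part of \<open>\<xi> (a * b)\<close> is not the product of the real
      parts. Replacing \<open>a\<close> by its self-adjoint part makes the first factor the real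
      number \<open>Re (\<xi> a)\<close>.\<close>
    proof (rule RI[of _ "((1/2) *\<^sub>C (a + star a)) * b"])
      fix \<xi> :: "'a \<Rightarrow> complex" assume \<xi>: "\<xi> \<in> spectrum"
      have "\<xi> (star a) = cnj (\<xi> a)"
        using spectrum_imp_is_state[OF \<xi>] by (simp add: positive_form_star is_state_iff)
      moreover have "\<xi> (x * y) = \<xi> x * \<xi> y" for x y
        using \<xi> by (simp add: spectrum_def)
      ultimately show "g \<xi> * h \<xi> = Re (\<xi> (((1/2) *\<^sub>C (a + star a)) * b))"
        using \<xi> by (simp add: a b cdualD[OF lin])
    qed
  next
    fix c :: real
    show "(\<lambda>_. c) \<in> R"
      by (rule RI[of _ "of_real c *\<^sub>C 1"]) (simp add: cdualD[OF lin] character_one)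
  next
    fix \<xi> \<eta> :: "'a \<Rightarrow> complex" assume *: "\<xi> \<in> spectrum" "\<eta> \<in> spectrum" "\<xi> \<noteq> \<eta>"
    then obtain a where "\<xi> a \<noteq> \<eta> a" by auto
    \<comment> \<open>Imaginary parts are, up to sign, real parts at
      \<open>\<i> *\<^sub>C a\<close>.\<close>
    then have "Re (\<xi> a) \<noteq> Re (\<eta> a) \<or> Re (\<xi> (\<i> *\<^sub>C a)) \<noteq> Re (\<eta> (\<i> *\<^sub>C a))"
      using * by (auto simp: complex_eq_iff cdualD[OF lin])
    moreover have "(\<lambda>\<xi>. Re (\<xi> b)) \<in> R" for b
      by (rule RI) simp
    ultimately show "\<exists>g\<in>R. g \<xi> \<noteq> g \<eta>"
      by (elim disjE) (rule bexI[rotated], assumption, simp)+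
  qed
  have "continuous_on spectrum f"
    using f by (simp add: spectrum_topology_eq)
  from Stone_Weierstrass_basic[OF this e] obtain g where "g \<in> R" "\<forall>\<xi>\<in>spectrum. \<bar>f \<xi> - g \<xi>\<bar> < e"
    by auto
  moreover from \<open>g \<in> R\<close> obtain a where "\<forall>\<xi>\<in>spectrum. g \<xi> = Re (\<xi> a)"
    by (auto simp: R_def)
  ultimately show thesis
    by (intro that[of a]) (simp add: less_imp_le)
qed

section \<open>Extension of a state to the continuous functions\<close>

lemma character_shift:
  "\<xi> \<in> spectrum \<Longrightarrow> \<xi> (a + of_real e *\<^sub>C 1) = \<xi> a + of_real e"
  by (simp add: spectrum_def cdualD character_one)

text \<open>A character dominating \<open>\<omega>\<close> at \<open>a - b\<close> transfers the
  bound.\<close>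

lemma state_le_add:
  fixes \<omega> :: "'a::comm_unital_cstar_algebra \<Rightarrow> complex"
  assumes "is_state \<omega>" and le: "\<And>\<xi>. \<xi> \<in> spectrum \<Longrightarrow> Re (\<xi> a) \<le> Re (\<xi> b) + e"
  shows "Re (\<omega> a) \<le> Re (\<omega> b) + e"
proof -
  obtain \<xi> where \<xi>: "\<xi> \<in> spectrum" "Re (\<omega> (a - b)) \<le> Re (\<xi> (a - b))"
    using exists_dominating_character[OF assms(1)] by blast
  have lin: "\<omega> \<in> cdual" "\<xi> \<in> cdual"
    using assms(1) \<xi>(1) by (auto simp: is_state_def spectrum_def)
  show ?thesis
    using \<xi>(2) le[OF \<xi>(1)] by (simp add: cdualD[OF lin(1)] cdualD[OF lin(2)])
qed

text \<open>The upper extension familiar from Hahn-Banach arguments: the infimum over majorants from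
  the algebra. It avoids choosing approximating sequences; uniform density makes it linear on
  continuous functions.\<close>

definition state_upper :: "('a::comm_unital_cstar_algebra \<Rightarrow> complex)
    \<Rightarrow> (('a \<Rightarrow> complex) \<Rightarrow> real) \<Rightarrow> real" where
  "state_upper \<omega> f = Inf {Re (\<omega> a) | a. \<forall>\<xi>\<in>spectrum. f \<xi> \<le> Re (\<xi> a)}"

text \<open>\<open>a + e\<close> is a majorant of \<open>f\<close>, and every majorant lies above
  \<open>a - e\<close> on the spectrum, hence under \<open>\<omega>\<close>. The infimum is
  therefore over a nonempty set that is bounded below.\<close>

lemma state_upper_approx:
  assumes \<omega>: "is_state \<omega>" and near: "\<And>\<xi>. \<xi> \<in> spectrum \<Longrightarrow> \<bar>f \<xi> - Re (\<xi> a)\<bar> \<le> e"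
  shows "\<bar>state_upper \<omega> f - Re (\<omega> a)\<bar> \<le> e"
proof -
  let ?S = "{Re (\<omega> b) | b. \<forall>\<xi>\<in>spectrum. f \<xi> \<le> Re (\<xi> b)}"
  have lin: "\<omega> \<in> cdual" and one: "\<omega> 1 = 1" using \<omega> by (auto simp: is_state_def)
  have "f \<xi> \<le> Re (\<xi> (a + of_real e *\<^sub>C 1))" if "\<xi> \<in> spectrum" for \<xi>
    using near[OF that] by (simp add: character_shift[OF that])
  then have upper: "Re (\<omega> (a + of_real e *\<^sub>C 1)) \<in> ?S" by blast
  have lower: "Re (\<omega> a) - e \<le> y" if y: "y \<in> ?S" for y
  proof -
    obtain b where b: "y = Re (\<omega> b)" "\<And>\<xi>. \<xi> \<in> spectrum \<Longrightarrow> f \<xi> \<le> Re (\<xi> b)"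
      using y by auto
    have "Re (\<omega> a) \<le> Re (\<omega> b) + e"
    proof (rule state_le_add[OF \<omega>])
      show "Re (\<xi> a) \<le> Re (\<xi> b) + e" if "\<xi> \<in> spectrum" for \<xi>
        using near[OF that] b(2)[OF that] by linarith
    qed
    then show ?thesis using b(1) by simp
  qed
  have "Inf ?S \<le> Re (\<omega> (a + of_real e *\<^sub>C 1))"
    using upper lower by (intro cInf_lower bdd_belowI)
  moreover have "Re (\<omega> a) - e \<le> Inf ?S"
    using upper lower by (intro cInf_greatest) auto
  ultimately show ?thesis
    by (simp add: state_upper_def cdualD[OF lin] one abs_le_iff)
qed

lemma state_upper_Re:
  assumes "is_state \<omega>"
  shows "state_upper \<omega> (\<lambda>\<xi>. Re (\<xi> a)) = Re (\<omega> a)"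
  using state_upper_approx[OF assms, of "\<lambda>\<xi>. Re (\<xi> a)" a 0] by simp

lemma eq_if_abs_diff_le_mult:
  fixes x y c :: real
  assumes "\<And>e. 0 < e \<Longrightarrow> \<bar>x - y\<bar> \<le> c * e"
  shows "x = y"
proof (rule ccontr)
  assume "x \<noteq> y"
  then have d: "0 < \<bar>x - y\<bar>" by simp
  define e where "e = \<bar>x - y\<bar> / (2 * (\<bar>c\<bar> + 1))"
  have e: "0 < e" using d by (simp add: e_def)
  have "\<bar>x - y\<bar> \<le> (\<bar>c\<bar> + 1) * e"
    using assms[OF e] mult_right_mono[of c "\<bar>c\<bar> + 1" e] e by linarith
  also have "\<dots> = \<bar>x - y\<bar> / 2"
    by (simp add: e_def field_simps)
  finally show False using d by simp
qed

text \<open>Each law holds for \<open>Re (\<omega> a)\<close> and passes to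
  \<open>state_upper\<close> through uniform approximants, with an error proportional to
  \<open>e\<close>.\<close>

lemma positive_functional_state_upper:
  fixes \<omega> :: "'a::comm_unital_cstar_algebra \<Rightarrow> complex"
  assumes \<omega>: "is_state \<omega>"
  shows "positive_functional spectrum_topology (state_upper \<omega>)"
proof
  note approx = state_upper_approx[OF \<omega>]
  have lin: "\<omega> \<in> cdual" and one: "\<omega> 1 = 1" using \<omega> by (auto simp: is_state_def)
  have clin: "\<xi> \<in> cdual" if "\<xi> \<in> spectrum" for \<xi> :: "'a \<Rightarrow> complex"
    using that by (simp add: spectrum_def)
  show "compact_space (spectrum_topology :: ('a \<Rightarrow> complex) topology)"
    by (rule compact_space_spectrum_topology)
  show "Hausdorff_space (spectrum_topology :: ('a \<Rightarrow> complex) topology)"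
    by (rule Hausdorff_space_spectrum_topology)
  show "state_upper \<omega> (\<lambda>_. 1) = 1"
    using approx[of "\<lambda>_. 1" 1 0] by (simp add: character_one one)
  fix f assume f: "continuous_map (spectrum_topology :: ('a \<Rightarrow> complex) topology) euclideanreal f"
  show "state_upper \<omega> (\<lambda>x. c * f x) = c * state_upper \<omega> f" for c
  proof (rule eq_if_abs_diff_le_mult)
    fix e :: real assume "0 < e"
    from spectrum_Stone_Weierstrass[OF f this]
    obtain a where a: "\<And>\<xi>. \<xi> \<in> spectrum \<Longrightarrow> \<bar>f \<xi> - Re (\<xi> a)\<bar> \<le> e" by blast
    have scaled: "\<bar>c * y - c * z\<bar> \<le> \<bar>c\<bar> * e" if "\<bar>y - z\<bar> \<le> e" for y z
      using mult_left_mono[OF that, of "\<bar>c\<bar>"] by (simp add: right_diff_distrib flip: abs_mult)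
    have "\<bar>state_upper \<omega> (\<lambda>x. c * f x) - Re (\<omega> (of_real c *\<^sub>C a))\<bar> \<le> \<bar>c\<bar> * e"
      using scaled[OF a] by (intro approx) (simp add: cdualD[OF clin])
    moreover have "\<bar>c * state_upper \<omega> f - c * Re (\<omega> a)\<bar> \<le> \<bar>c\<bar> * e"
      using a by (intro scaled approx)
    moreover have "Re (\<omega> (of_real c *\<^sub>C a)) = c * Re (\<omega> a)"
      by (simp add: cdualD[OF lin])
    ultimately show "\<bar>state_upper \<omega> (\<lambda>x. c * f x) - c * state_upper \<omega> f\<bar> \<le> (2 * \<bar>c\<bar>) * e"
      by linarith
  qed
  fix g assume g: "continuous_map (spectrum_topology :: ('a \<Rightarrow> complex) topology) euclideanreal g"
  show "state_upper \<omega> (\<lambda>x. f x + g x) = state_upper \<omega> f + state_upper \<omega> g"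
  proof (rule eq_if_abs_diff_le_mult)
    fix e :: real assume e: "0 < e"
    from spectrum_Stone_Weierstrass[OF f e]
    obtain a where a: "\<And>\<xi>. \<xi> \<in> spectrum \<Longrightarrow> \<bar>f \<xi> - Re (\<xi> a)\<bar> \<le> e" by blast
    from spectrum_Stone_Weierstrass[OF g e]
    obtain b where b: "\<And>\<xi>. \<xi> \<in> spectrum \<Longrightarrow> \<bar>g \<xi> - Re (\<xi> b)\<bar> \<le> e" by blast
    have "\<bar>state_upper \<omega> (\<lambda>x. f x + g x) - Re (\<omega> (a + b))\<bar> \<le> 2 * e"
    proof (rule approx)
      show "\<bar>f \<xi> + g \<xi> - Re (\<xi> (a + b))\<bar> \<le> 2 * e" if "\<xi> \<in> spectrum" for \<xi>
        using a[OF that] b[OF that] by (simp add: cdualD[OF clin[OF that]])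
    qed
    with approx[of f a e, OF a] approx[of g b e, OF b]
    show "\<bar>state_upper \<omega> (\<lambda>x. f x + g x) - (state_upper \<omega> f + state_upper \<omega> g)\<bar> \<le> 4 * e"
      by (simp add: cdualD[OF lin])
  qed
  assume le: "\<And>x. x \<in> topspace spectrum_topology \<Longrightarrow> f x \<le> g x"
  show "state_upper \<omega> f \<le> state_upper \<omega> g"
  proof (rule field_le_epsilon)
    fix e :: real assume "0 < e"
    \<comment> \<open>Error budget: \<open>e / 4\<close> for each of the two approximations of
      \<open>state_upper\<close>, and \<open>e / 2\<close> between the approximants.\<close>
    then have e: "0 < e / 4" by simp
    from spectrum_Stone_Weierstrass[OF f e]
    obtain a where a: "\<And>\<xi>. \<xi> \<in> spectrum \<Longrightarrow> \<bar>f \<xi> - Re (\<xi> a)\<bar> \<le> e / 4" by blast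
    from spectrum_Stone_Weierstrass[OF g e]
    obtain b where b: "\<And>\<xi>. \<xi> \<in> spectrum \<Longrightarrow> \<bar>g \<xi> - Re (\<xi> b)\<bar> \<le> e / 4" by blast
    have "Re (\<omega> a) \<le> Re (\<omega> b) + e / 2"
    proof (rule state_le_add[OF \<omega>])
      show "Re (\<xi> a) \<le> Re (\<xi> b) + e / 2" if "\<xi> \<in> spectrum" for \<xi>
        using a[OF that] b[OF that] le[unfolded topspace_spectrum_topology, OF that] by linarith
    qed
    with approx[of f a "e / 4", OF a] approx[of g b "e / 4", OF b]
    show "state_upper \<omega> f \<le> state_upper \<omega> g + e"
      by linarith
  qed
qed

text \<open>Both sides are within \<open>e\<close> of \<open>Re (\<omega> a)\<close> for an
  approximant \<open>a\<close>. Thus \<open>\<omega>\<close> alone determines the integrals of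
  continuous functions, which is what uniqueness needs.\<close>

lemma integral_eq_if_evaluation_integral_eq:
  fixes \<omega> :: "'a::comm_unital_cstar_algebra \<Rightarrow> complex"
  assumes \<omega>: "is_state \<omega>"
    and M: "regular_borel_measure spectrum_topology M" "prob_space M"
    and int: "\<And>a. has_bochner_integral M (evaluation a) (\<omega> a)"
    and f: "continuous_map spectrum_topology euclideanreal f"
  shows "(\<integral>\<xi>. f \<xi> \<partial>M) = state_upper \<omega> f"
proof (rule eq_if_abs_diff_le_mult)
  interpret M: prob_space M by (rule M)
  fix e :: real assume e: "0 < e"
  from spectrum_Stone_Weierstrass[OF f e]
  obtain a where a: "\<And>\<xi>. \<xi> \<in> spectrum \<Longrightarrow> \<bar>f \<xi> - Re (\<xi> a)\<bar> \<le> e" by blast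
  have sets: "sets M = sets (borel_of spectrum_topology)"
    using M(1) by (simp add: regular_borel_measure_def)
  then have space: "space M = spectrum"
    using sets_eq_imp_space_eq[OF sets] by (simp add: space_borel_of topspace_spectrum_topology)
  have intf: "integrable M f"
    by (rule integrable_continuous_map[OF compact_space_spectrum_topology M(2) sets f])
  have inta: "has_bochner_integral M (\<lambda>\<xi>. Re (\<xi> a)) (Re (\<omega> a))"
    using has_bochner_integral_Re[OF int[of a]] by (simp add: evaluation_def)
  then have "(\<integral>\<xi>. f \<xi> \<partial>M) - Re (\<omega> a) = (\<integral>\<xi>. f \<xi> - Re (\<xi> a) \<partial>M)"
    using intf by (simp add: has_bochner_integral_iff)
  also have "\<bar>\<dots>\<bar> \<le> (\<integral>\<xi>. \<bar>f \<xi> - Re (\<xi> a)\<bar> \<partial>M)"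
    by (rule integral_abs_bound)
  also have "\<dots> \<le> (\<integral>\<xi>. e \<partial>M)"
    using inta intf a by (intro integral_mono) (auto simp: has_bochner_integral_iff space)
  also have "\<dots> = e" by (simp add: M.prob_space)
  finally show "\<bar>(\<integral>\<xi>. f \<xi> \<partial>M) - state_upper \<omega> f\<bar> \<le> 2 * e"
    using state_upper_approx[OF \<omega>, of f a e, OF a] by linarith
qed

text \<open>Uniqueness is equality of measure objects, with the sigma-algebra fixed by
  \<open>regular_borel_measure\<close>. \<open>has_bochner_integral\<close> asserts integrability
  together with the value.\<close>

theorem theorem4p134:
  fixes \<omega> :: "'a::comm_unital_cstar_algebra \<Rightarrow> complex"
  assumes "is_state \<omega>"
  shows "\<exists>!\<mu>. regular_borel_measure spectrum_topology \<mu> \<and> prob_space \<mu> \<and>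
           (\<forall>a. has_bochner_integral \<mu> (evaluation a) (\<omega> a))"
proof (rule ex_ex1I)
  interpret L: positive_functional spectrum_topology "state_upper \<omega>"
    using assms by (rule positive_functional_state_upper)
  have lin: "\<omega> \<in> cdual" using assms by (simp add: is_state_def)
  have Re: "has_bochner_integral L.representing (\<lambda>\<xi>. Re (\<xi> a)) (Re (\<omega> a))" for a
  proof -
    have "continuous_map spectrum_topology euclideanreal (\<lambda>\<xi>. Re (\<xi> a))"
      unfolding spectrum_topology_eq
      by (simp add: continuous_on_Re continuous_on_subset[OF continuous_on_product_coordinates])
    from L.has_bochner_integral_representing[OF this] show ?thesis
      by (simp add: state_upper_Re[OF assms])
  qed
  have "has_bochner_integral L.representing (evaluation a) (\<omega> a)" for a
  proof -
    \<comment> \<open>The imaginary part at \<open>a\<close> is the real part at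
      \<open>(-\<i>) *\<^sub>C a\<close>.\<close>
    have "has_bochner_integral L.representing (\<lambda>\<xi>. Im (\<xi> a)) (Im (\<omega> a))"
    proof (rule has_bochner_integral_cong[THEN iffD1, OF refl _ _ Re[of "(-\<i>) *\<^sub>C a"]])
      show "Re (\<xi> ((-\<i>) *\<^sub>C a)) = Im (\<xi> a)" if "\<xi> \<in> space L.representing" for \<xi>
        using that by (simp add: L.space_representing topspace_spectrum_topology spectrum_def cdualD)
    qed (simp add: cdualD[OF lin])
    then have "has_bochner_integral L.representing
        (\<lambda>\<xi>. of_real (Re (\<xi> a)) + \<i> * of_real (Im (\<xi> a))) (of_real (Re (\<omega> a)) + \<i> * of_real (Im (\<omega> a)))"
      by (intro has_bochner_integral_add has_bochner_integral_mult_right has_bochner_integral_of_real Re)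
    then show ?thesis
      by (simp add: evaluation_def[abs_def] complex_eq_iff flip: complex_eq)
  qed
  then show "\<exists>\<mu>. regular_borel_measure spectrum_topology \<mu> \<and> prob_space \<mu> \<and>
      (\<forall>a. has_bochner_integral \<mu> (evaluation a) (\<omega> a))"
    using L.regular_representing L.prob_space_representing by blast
  fix \<mu> \<nu>
  assume \<mu>: "regular_borel_measure spectrum_topology \<mu> \<and> prob_space \<mu> \<and>
      (\<forall>a. has_bochner_integral \<mu> (evaluation a) (\<omega> a))"
    and \<nu>: "regular_borel_measure spectrum_topology \<nu> \<and> prob_space \<nu> \<and>
      (\<forall>a. has_bochner_integral \<nu> (evaluation a) (\<omega> a))"
  show "\<mu> = \<nu>"
    using \<mu> \<nu> integral_eq_if_evaluation_integral_eq[OF assms]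
    by (intro regular_borel_measure_eqI[OF compact_space_spectrum_topology Hausdorff_space_spectrum_topology])
       auto
qed

end
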